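(* Let $n\ge2$ be an integer. Then the following assertions hold. (i) If $n$ is odd, there exists a parabolic $n$-translator $\Sigma$ in $\mathbb H^n\times\mathbb R$ (called the parabolic $n$-grim reaper) which has the following properties: - $\Sigma$ is a vertical graph over the open region of $\mathbb H^n$ bounded by two parallel horospheres $\mathcal H_{\pm}$. In particular, $\Sigma$ is homeomorphic to $\mathbb R^n$. - The height of $\Sigma$ is bounded from below and unbounded from above, and $\Sigma$ is vertically asymptotic to both cylinders $\mathcal H_\pm\times\mathbb R$. - $\Sigma$ is $C^2$-singular along the horosphere of minimal height. (ii) If $n$ is even, there exists a parabolic $n$-translator $\Sigma$ in $\mathbb H^n\times\mathbb R$ with nonempty boundary (called the parabolic $n$-grim reaper) which has the following properties: - $\Sigma$ is a vertical graph over the open region of $\mathbb H^n$ bounded by two parallel horospheres $\mathcal H_0$ and $\mathcal H_+$. - The height of $\Sigma$ is bounded from below and unbounded from above. - $\Sigma$ is tangent to $\mathbb H^n\times\{0\}$ along $\mathcal H_0\times\{0\}$, where it reaches its minimal height, and it is vertically asymptotic to $\mathcal H_+\times\mathbb R$.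
   Context: $\mathbb H^n\times\mathbb R$ carries the product metric, $\partial_t$ is the unit vertical field (gradient of the projection onto $\mathbb R$). The height function of a hypersurface is the restriction of the projection onto $\mathbb R$. For an oriented hypersurface $\Sigma$ with unit normal $N$, the shape operator is $AX=-\overline\nabla_XN$ ($\overline\nabla$ the ambient Levi-Civita connection), with principal curvatures $k_1,\dots,k_n$; $H_n=k_1\cdots k_n$ is the Gaussian curvature and $\Theta=\langle N,\partial_t\rangle$ is the angle function. Hypersurfaces are of class at least $C^2$ except possibly on a set $\Lambda$ of null measure, where they are only of class $C^1$; then $\Sigma$ is called $C^2$-singular on $\Lambda$. $\Sigma$ is an $n$-translator (translator to the Gaussian curvature flow) if $H_n=\Theta$ on $\Sigma$ (on $\Sigma-\Lambda$ if there is a $C^2$-singular set $\Lambda$). A hypersurface of $\mathbb H^n\times\mathbb R$ is parabolic if it is invariant under the parabolic translations of $\mathbb H^n$ fixing a family of parallel horospheres centered at a common point of $\partial_\infty\mathbb H^n$, extended to $\mathbb H^n\times\mathbb R$ by fixing the $\mathbb R$ factor; such a hypersurface is foliated by vertical translates of these horospheres. *)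

theory Defs
  imports "HOL-Analysis.Analysis"
begin

text \<open>
  With \<open>'a\<close> of dimension \<open>n - 1\<close>, the type \<^typ>\<open>'a \<times> real\<close> is an \<open>n\<close>-dimensional Euclidean space,
  and hyperbolic \<open>n\<close>-space is the upper half-space in it. Tangent vectors are identified with
  elements of the ambient vector space.
\<close>

definition hyp :: "('a::euclidean_space \<times> real) set" where
  "hyp = {z. 0 < snd z}"

definition hyp_dist :: "'a::euclidean_space \<times> real \<Rightarrow> 'a \<times> real \<Rightarrow> real" where
  "hyp_dist z w = arcosh (1 + (dist z w)\<^sup>2 / (2 * snd z * snd w))"

type_synonym 'a hyp_line = "('a \<times> real) \<times> real"

definition riem_metric :: "'a::euclidean_space hyp_line \<Rightarrow> 'a hyp_line \<Rightarrow> 'a hyp_line \<Rightarrow> real" where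
  "riem_metric p u v = (fst u \<bullet> fst v) / (snd (fst p))\<^sup>2 + snd u * snd v"

definition vertical :: "'a::euclidean_space hyp_line" where
  "vertical = (0, 1)"

definition height :: "'a::euclidean_space hyp_line \<Rightarrow> real" where
  "height p = snd p"

text \<open>
  The Levi-Civita connection is given by the Koszul formula, here for constant vector fields
  (whose Lie brackets vanish): \<open>christoffel p u v\<close> is the covariant derivative at \<open>p\<close> of the
  constant field \<open>v\<close> in the direction \<open>u\<close>.
\<close>

definition christoffel :: "'a::euclidean_space hyp_line \<Rightarrow> 'a hyp_line \<Rightarrow> 'a hyp_line \<Rightarrow> 'a hyp_line" where
  "christoffel p u v = (THE w. \<forall>z. 2 * riem_metric p w z =
       frechet_derivative (\<lambda>q. riem_metric q v z) (at p) u
     + frechet_derivative (\<lambda>q. riem_metric q u z) (at p) v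
     - frechet_derivative (\<lambda>q. riem_metric q u v) (at p) z)"

text \<open>
  Covariant derivative in direction \<open>X\<close> of a vector field \<open>V\<close> given along a hypersurface \<open>S\<close>.
  The derivative within \<open>S\<close> is only determined on vectors tangent to \<open>S\<close>.
\<close>

definition cov_deriv :: "'a::euclidean_space hyp_line set \<Rightarrow> ('a hyp_line \<Rightarrow> 'a hyp_line) \<Rightarrow>
    'a hyp_line \<Rightarrow> 'a hyp_line \<Rightarrow> 'a hyp_line" where
  "cov_deriv S V p X = frechet_derivative V (at p within S) X + christoffel p X (V p)"

text \<open>
  Class \<open>C\<^sup>k\<close> on an open set. As the domain is finite-dimensional, the derivative is of class \<open>C\<^sup>k\<close>
  iff all directional derivatives are.
\<close>

primrec Ck_on :: "nat \<Rightarrow> ('b::euclidean_space \<Rightarrow> 'c::euclidean_space) \<Rightarrow> 'b set \<Rightarrow> bool" where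
  "Ck_on 0 f U \<longleftrightarrow> continuous_on U f"
| "Ck_on (Suc k) f U \<longleftrightarrow> (\<forall>z\<in>U. f differentiable (at z)) \<and>
     (\<forall>v. Ck_on k (\<lambda>z. frechet_derivative f (at z) v) U)"

text \<open>
  Local parametrization \<open>f\<close> of class \<open>C\<^sup>k\<close> of the piece \<open>S \<inter> W\<close> of \<open>S\<close>, with domain \<open>U \<inter> K\<close>,
  where \<open>K\<close> is the whole space, or a closed half-space to allow for boundary points.
\<close>

definition local_param :: "nat \<Rightarrow> 'a::euclidean_space hyp_line set \<Rightarrow> ('a \<times> real) set \<Rightarrow>
    ('a \<times> real) set \<Rightarrow> ('a \<times> real \<Rightarrow> 'a hyp_line) \<Rightarrow> 'a hyp_line set \<Rightarrow> bool" where
  "local_param k S K U f W \<longleftrightarrow> open U \<and> open W \<and> Ck_on k f U \<and>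
     (\<forall>z\<in>U. inj (frechet_derivative f (at z))) \<and>
     (\<exists>g. homeomorphism (U \<inter> K) (S \<inter> W) f g)"

definition model_spaces :: "('a::euclidean_space \<times> real) set set" where
  "model_spaces = {UNIV, {z. 0 \<le> snd z}}"

definition regular_at :: "nat \<Rightarrow> 'a::euclidean_space hyp_line set \<Rightarrow> 'a hyp_line \<Rightarrow> bool" where
  "regular_at k S p \<longleftrightarrow> (\<exists>K\<in>model_spaces. \<exists>U f W. local_param k S K U f W \<and> p \<in> S \<inter> W)"

definition hs_boundary :: "'a::euclidean_space hyp_line set \<Rightarrow> 'a hyp_line set" where
  "hs_boundary S = {p\<in>S. \<nexists>U f W. local_param 1 S UNIV U f W \<and> p \<in> W}"

definition C2_singular_set :: "'a::euclidean_space hyp_line set \<Rightarrow> 'a hyp_line set" where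
  "C2_singular_set S = {p\<in>S. \<not> regular_at 2 S p}"

text \<open>
  Vanishing \<open>n\<close>-dimensional measure in a \<open>C\<^sup>1\<close> hypersurface. As changes of parameters are
  \<open>C\<^sup>1\<close> diffeomorphisms, it does not matter which parametrization is taken around each point.
\<close>

definition null_in :: "'a::euclidean_space hyp_line set \<Rightarrow> 'a hyp_line set \<Rightarrow> bool" where
  "null_in S L \<longleftrightarrow> (\<forall>p\<in>S. \<exists>K\<in>model_spaces. \<exists>U f W. local_param 1 S K U f W \<and> p \<in> W \<and>
     negligible {z \<in> U \<inter> K. f z \<in> L})"

definition hypersurface :: "'a::euclidean_space hyp_line set \<Rightarrow> bool" where
  "hypersurface S \<longleftrightarrow> S \<noteq> {} \<and> S \<subseteq> hyp \<times> UNIV \<and> (\<forall>p\<in>S. regular_at 1 S p) \<and>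
     null_in S (C2_singular_set S)"

text \<open>
  One-sided curves and the linear span make the definition apply at boundary points; at interior
  points this is the usual set of velocities of curves in \<open>S\<close>.
\<close>

definition tangent_space :: "'a::euclidean_space hyp_line set \<Rightarrow> 'a hyp_line \<Rightarrow> 'a hyp_line set" where
  "tangent_space S p = span {v. \<exists>c e. 0 < e \<and> c 0 = p \<and> c ` {0..<e} \<subseteq> S \<and>
     (c has_vector_derivative v) (at (0::real) within {0..<e})}"

definition unit_normal :: "'a::euclidean_space hyp_line set \<Rightarrow> ('a hyp_line \<Rightarrow> 'a hyp_line) \<Rightarrow> bool" where
  "unit_normal S N \<longleftrightarrow> continuous_on S N \<and>
     (\<forall>p\<in>S. riem_metric p (N p) (N p) = 1 \<and> (\<forall>v\<in>tangent_space S p. riem_metric p (N p) v = 0))"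

definition shape_operator :: "'a::euclidean_space hyp_line set \<Rightarrow> ('a hyp_line \<Rightarrow> 'a hyp_line) \<Rightarrow>
    'a hyp_line \<Rightarrow> 'a hyp_line \<Rightarrow> 'a hyp_line" where
  "shape_operator S N p X = - cov_deriv S N p X"

text \<open>\<open>k 0, \<dots>, k (n - 1)\<close> are the eigenvalues, with multiplicity, of the shape operator at \<open>p\<close>.\<close>

definition principal_curvatures :: "'a::euclidean_space hyp_line set \<Rightarrow>
    ('a hyp_line \<Rightarrow> 'a hyp_line) \<Rightarrow> 'a hyp_line \<Rightarrow> (nat \<Rightarrow> real) \<Rightarrow> bool" where
  "principal_curvatures S N p k \<longleftrightarrow> (\<exists>e.
     (\<forall>i<DIM('a \<times> real). \<forall>j<DIM('a \<times> real). riem_metric p (e i) (e j) = (if i = j then 1 else 0)) \<and>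
     span (e ` {..<DIM('a \<times> real)}) = tangent_space S p \<and>
     (\<forall>i<DIM('a \<times> real). shape_operator S N p (e i) = k i *\<^sub>R e i))"

definition has_gauss_curvature :: "'a::euclidean_space hyp_line set \<Rightarrow>
    ('a hyp_line \<Rightarrow> 'a hyp_line) \<Rightarrow> 'a hyp_line \<Rightarrow> real \<Rightarrow> bool" where
  "has_gauss_curvature S N p H \<longleftrightarrow>
     (\<exists>k. principal_curvatures S N p k \<and> H = (\<Prod>i<DIM('a \<times> real). k i))"

definition angle_function :: "('a::euclidean_space hyp_line \<Rightarrow> 'a hyp_line) \<Rightarrow> 'a hyp_line \<Rightarrow> real" where
  "angle_function N p = riem_metric p (N p) vertical"

definition n_translator :: "'a::euclidean_space hyp_line set \<Rightarrow> bool" where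
  "n_translator S \<longleftrightarrow> hypersurface S \<and> (\<exists>N. unit_normal S N \<and>
     (\<forall>p \<in> S - C2_singular_set S. has_gauss_curvature S N p (angle_function N p)))"

text \<open>
  Points of the ideal boundary are \<open>None\<close>, the point at infinity of the half-space, and \<open>Some a\<close>,
  the point \<open>(a, 0)\<close>. The inversion in the unit sphere about \<open>(a, 0)\<close> is an involutive isometry of
  hyperbolic space exchanging \<open>Some a\<close> and \<open>None\<close>. Horospheres centred at \<open>None\<close> are the
  horizontal hyperplanes, and the parabolic translations fixing each of them are the horizontal
  Euclidean translations.
\<close>

fun to_infinity :: "'a::euclidean_space option \<Rightarrow> 'a \<times> real \<Rightarrow> 'a \<times> real" where
  "to_infinity None z = z"
| "to_infinity (Some a) z = (a, 0) + (1 / (norm (z - (a, 0)))\<^sup>2) *\<^sub>R (z - (a, 0))"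

text \<open>Signed distance between parallel horospheres (a Busemann function, up to sign).\<close>

definition horo_level :: "'a::euclidean_space option \<Rightarrow> 'a \<times> real \<Rightarrow> real" where
  "horo_level \<xi> z = ln (snd (to_infinity \<xi> z))"

definition horosphere :: "'a::euclidean_space option \<Rightarrow> real \<Rightarrow> ('a \<times> real) set" where
  "horosphere \<xi> c = {z\<in>hyp. horo_level \<xi> z = c}"

definition horo_region :: "'a::euclidean_space option \<Rightarrow> real \<Rightarrow> real \<Rightarrow> ('a \<times> real) set" where
  "horo_region \<xi> a b = {z\<in>hyp. min a b < horo_level \<xi> z \<and> horo_level \<xi> z < max a b}"

definition parabolic_translation :: "'a::euclidean_space option \<Rightarrow> 'a \<Rightarrow> 'a \<times> real \<Rightarrow> 'a \<times> real" where
  "parabolic_translation \<xi> v z = to_infinity \<xi> (to_infinity \<xi> z + (v, 0))"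

definition parabolic :: "'a::euclidean_space option \<Rightarrow> 'a hyp_line set \<Rightarrow> bool" where
  "parabolic \<xi> S \<longleftrightarrow> (\<forall>v. (\<lambda>(z, t). (parabolic_translation \<xi> v z, t)) ` S = S)"

definition vertical_graph :: "('a::euclidean_space \<times> real) set \<Rightarrow> 'a hyp_line set \<Rightarrow> bool" where
  "vertical_graph D S \<longleftrightarrow> (\<exists>u. Ck_on 1 u D \<and> S = (\<lambda>z. (z, u z)) ` D)"

definition lowest_points :: "'a::euclidean_space hyp_line set \<Rightarrow> 'a hyp_line set" where
  "lowest_points S = {p\<in>S. \<forall>q\<in>S. height p \<le> height q}"

text \<open>
  \<open>S\<close> is asymptotic, as the height tends to infinity, to the cylinder \<open>C \<times> \<real>\<close> (or to all the
  cylinders in question, if \<open>C\<close> is a union): the horizontal slices of \<open>S\<close> at height \<open>t\<close> converge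
  to \<open>C\<close> in Hausdorff distance, and the height tends to infinity as \<open>C\<close> is approached along \<open>S\<close>.
\<close>

definition vertically_asymptotic :: "'a::euclidean_space hyp_line set \<Rightarrow> ('a \<times> real) set \<Rightarrow> bool" where
  "vertically_asymptotic S C \<longleftrightarrow>
     (\<forall>\<epsilon>>0. \<exists>h. \<forall>t>h. (\<forall>w\<in>C. \<exists>z. (z, t) \<in> S \<and> hyp_dist z w < \<epsilon>) \<and>
                       (\<forall>z. (z, t) \<in> S \<longrightarrow> (\<exists>w\<in>C. hyp_dist z w < \<epsilon>))) \<and>
     (\<forall>h. \<exists>\<delta>>0. \<forall>(z, t)\<in>S. (\<exists>w\<in>C. hyp_dist z w < \<delta>) \<longrightarrow> h < t)"

end

theory Submission
  imports Defs
begin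

text \<open>
  Put \<open>m = n - 1\<close> and take the centre of the horospheres to be the point at infinity of the
  half-space, so that they are the level sets of \<open>s = ln y\<close>, where \<open>y > 0\<close> is the last coordinate of
  the half-space, and \<open>s\<close> is arc length along their common orthogonal geodesics. A parabolic graph
  has an equation \<open>t = \<phi> s\<close>. Describe it by the inclination \<open>\<theta>\<close> of its profile curve,
  \<open>\<phi>' = tan \<theta>\<close>. Its upward unit normal is \<open>cos \<theta> \<partial>\<^sub>t - sin \<theta> \<partial>\<^sub>s\<close>. Horospheres are umbilic with
  curvature 1, so all \<open>m\<close> horospherical directions have principal curvature \<open>- sin \<theta>\<close>, whereas the
  profile curve contributes \<open>cos \<theta> \<theta>'\<close>. Hence the translator equation reads
  \<open>(- sin \<theta>) ^ m cos \<theta> \<theta>' = cos \<theta>\<close>; reversing the normal replaces \<open>- sin \<theta>\<close> by \<open>sin \<theta>\<close>.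
  Where the sign is right it says \<open>\<bar>sin \<theta>\<bar> ^ m \<theta>' = 1\<close>, which is solved by inverting
  \<open>s = F \<theta>\<close>, where \<open>F \<theta>\<close> is the integral of \<open>\<bar>sin \<tau>\<bar> ^ m\<close> over \<open>0 \<le> \<tau> \<le> \<theta>\<close>.

  All qualitative properties can be read off from this formula. Since \<open>L = F (pi / 2)\<close> is finite, the
  solution lives over the slab \<open>\<bar>s\<bar> < L\<close> between two horospheres. Since the integral of
  \<open>tan \<tau> sin \<tau> ^ m\<close> diverges at \<open>pi / 2\<close>, the height tends to infinity at both of them. Since \<open>0\<close>
  is the only zero of \<open>F'\<close> in \<open>[- pi / 2, pi / 2]\<close>, \<open>\<theta>\<close> is continuous but \<open>\<theta>'\<close> is infinite
  at \<open>s = 0\<close>, so that the graph is \<open>C\<^sup>2\<close> away from its minimum and only \<open>C\<^sup>1\<close> there.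

  The parity of \<open>n\<close> enters through the sign only. If \<open>n\<close> is odd, \<open>m\<close> is even,
  \<open>(- sin \<theta>) ^ m = \<bar>sin \<theta>\<bar> ^ m\<close> holds for both signs of \<open>\<theta>\<close>, and the graph over the whole
  slab is a translator. If \<open>n\<close> is even, one takes the downward normal, and
  \<open>sin \<theta> ^ m = \<bar>sin \<theta>\<bar> ^ m\<close> forces \<open>\<theta> \<ge> 0\<close>: only the half \<open>0 \<le> s < L\<close> survives, and the
  horosphere of minimal height becomes a boundary along which the graph is horizontal.

  The solution of the ordinary differential equation is \<open>reaper_profile_exists\<close>; the curvature is
  computed in \<open>gauss_curvature_eq_angle\<close>; the singular set is found in
  \<open>C2_singular_set_level_zero\<close>, whose essential half is \<open>not_C2_at_level_zero\<close>, and the boundary in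
  \<open>minimal_point_is_boundary\<close>.
\<close>

section \<open>Calculus preliminaries\<close>

lemma frechet_derivative_eqI:
  "(f has_derivative f') (at x) \<Longrightarrow> frechet_derivative f (at x) = f'"
  by (rule frechet_derivative_at[symmetric])

lemma Ck_on_cong:
  assumes "open U" "\<And>z. z \<in> U \<Longrightarrow> f z = g z"
  shows "Ck_on k f U \<longleftrightarrow> Ck_on k g U"
  using assms(2)
proof (induction k arbitrary: f g)
  case 0
  then show ?case by (simp cong: continuous_on_cong)
next
  case (Suc k)
  have der: "(f has_derivative D) (at z) \<longleftrightarrow> (g has_derivative D) (at z)" if "z \<in> U" for z D
    using has_derivative_transform_within_open[OF _ assms(1) that] Suc.prems by metis
  then have "frechet_derivative f (at z) = frechet_derivative g (at z)" if "z \<in> U" for z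
    using that by (simp add: frechet_derivative_def)
  then have "Ck_on k (\<lambda>z. frechet_derivative f (at z) v) U \<longleftrightarrow>
      Ck_on k (\<lambda>z. frechet_derivative g (at z) v) U" for v
    by (intro Suc.IH) auto
  then show ?case using der by (auto simp: differentiable_def)
qed

text \<open>
  Reduces \<open>C\<^sup>k\<close> regularity on an open set to an explicit formula for the derivative, so that
  Frechet derivatives given by a choice operator never have to be differentiated.
\<close>

lemma Ck_on_SucI:
  assumes "open U" "\<And>z. z \<in> U \<Longrightarrow> (f has_derivative D z) (at z)"
    and "\<And>v. Ck_on k (\<lambda>z. D z v) U"
  shows "Ck_on (Suc k) f U"
proof -
  have "Ck_on k (\<lambda>z. frechet_derivative f (at z) v) U" for v
    using assms(3)[of v] Ck_on_cong[OF assms(1), of "\<lambda>z. frechet_derivative f (at z) v" "\<lambda>z. D z v" k]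
      frechet_derivative_eqI[OF assms(2)] by simp
  then show ?thesis using assms(2) by (auto simp: differentiable_def)
qed

lemma has_derivative_comp_snd:
  assumes "(g has_real_derivative d) (at (snd z))"
  shows "((\<lambda>z. g (snd z)) has_derivative (\<lambda>v. d * snd v)) (at z)"
  using has_derivative_compose[OF has_derivative_snd[OF has_derivative_ident], of g "(*) d" z UNIV] assms
  by (simp add: has_field_derivative_def)

lemma continuous_on_comp_snd:
  fixes g :: "real \<Rightarrow> real"
  assumes "\<And>s. s \<in> I \<Longrightarrow> isCont g s"
  shows "continuous_on {z. snd z \<in> I} (\<lambda>z. g (snd z))"
  by (rule continuous_on_compose2[where g=g and t=I])
     (auto intro!: continuous_intros continuous_at_imp_continuous_on assms)

lemma open_strip: "open I \<Longrightarrow> open {z :: 'a::euclidean_space \<times> real. snd z \<in> I}"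
  by (rule open_vimage[unfolded vimage_def]) (auto intro: continuous_intros)

lemma strip_homeomorphic_UNIV:
  assumes "a < (b::real)"
  shows "{z :: 'a::euclidean_space \<times> real. snd z \<in> {a<..<b}} homeomorphic (UNIV :: ('a \<times> real) set)"
proof -
  obtain f g where h: "homeomorphism {a<..<b} (UNIV :: real set) f g"
    using homeomorphic_open_interval_UNIV[OF assms] homeomorphic_def by blast
  have "homeomorphism {z :: 'a \<times> real. snd z \<in> {a<..<b}} UNIV
      (\<lambda>z. (fst z, f (snd z))) (\<lambda>z. (fst z, g (snd z)))"
  proof
    show "continuous_on {z :: 'a \<times> real. snd z \<in> {a<..<b}} (\<lambda>z. (fst z, f (snd z)))"
      by (intro continuous_intros continuous_on_compose2[OF homeomorphism_cont1[OF h]]) auto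
    show "continuous_on UNIV (\<lambda>z :: 'a \<times> real. (fst z, g (snd z)))"
      by (intro continuous_intros continuous_on_compose2[OF homeomorphism_cont2[OF h]]) auto
  qed (use homeomorphism_image2[OF h] homeomorphism_apply1[OF h] homeomorphism_apply2[OF h] in auto)
  then show ?thesis unfolding homeomorphic_def by blast
qed

lemma negligible_horizontal: "negligible {z :: 'a::euclidean_space \<times> real. snd z = c}"
  using negligible_hyperplane[of "(0::'a, 1::real)" c] by (simp add: inner_prod_def zero_prod_def)

lemma mem_sym_interval:
  fixes s L :: real shows "I \<subseteq> {-L<..<L} \<Longrightarrow> s \<in> I \<Longrightarrow> \<bar>s\<bar> < L"
  by (force simp: abs_less_iff)

lemma at_within_Ico_nontrivial:
  fixes a e :: real assumes "0 \<le> a" "a < e" shows "at a within {0..<e} \<noteq> bot"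
proof -
  have "at a within {a<..<e} \<le> at a within {0..<e}"
    using assms by (intro at_le) auto
  moreover have "at a within {a<..<e} \<noteq> bot"
    using assms by (simp add: at_within_eq_bot_iff)
  ultimately show ?thesis by (metis bot.extremum_unique)
qed

lemma straight_path_velocity:
  fixes f :: "'b::euclidean_space \<Rightarrow> 'c::euclidean_space"
  assumes "f differentiable (at (z + t *\<^sub>R v))"
  shows "((\<lambda>t. f (z + t *\<^sub>R v)) has_vector_derivative
           frechet_derivative f (at (z + t *\<^sub>R v)) v) (at t within T)"
proof -
  have "((\<lambda>t. z + t *\<^sub>R v) has_vector_derivative v) (at t within T)"
    by (auto intro!: derivative_eq_intros simp: has_vector_derivative_def)
  moreover have "(f has_derivative frechet_derivative f (at (z + t *\<^sub>R v)))
      (at (z + t *\<^sub>R v) within (\<lambda>t. z + t *\<^sub>R v) ` T)"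
    using assms frechet_derivative_works has_derivative_at_withinI by blast
  ultimately show ?thesis
    using vector_derivative_diff_chain_within by (fastforce simp: o_def)
qed

text \<open>
  At a boundary point of a half-space model only the rays pointing inwards are available. Since
  either \<open>v\<close> or \<open>- v\<close> points inwards, they still determine a linear map.
\<close>

lemma ray_in_model_space:
  assumes "K \<in> model_spaces" "open U" "z \<in> U \<inter> K" "0 \<le> snd v"
  obtains e where "0 < e" "\<And>t. 0 \<le> t \<Longrightarrow> t < e \<Longrightarrow> z + t *\<^sub>R v \<in> U \<inter> K"
proof -
  have "((\<lambda>t. z + t *\<^sub>R v) \<longlongrightarrow> z + 0 *\<^sub>R v) (at_right 0)"
    by (intro tendsto_intros)
  then have "\<forall>\<^sub>F t in at_right 0. z + t *\<^sub>R v \<in> U"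
    using topological_tendstoD[of "\<lambda>t. z + t *\<^sub>R v" "z + 0 *\<^sub>R v" _ U] assms by simp
  then obtain e where e: "0 < e" "\<And>t. 0 < t \<Longrightarrow> t < e \<Longrightarrow> z + t *\<^sub>R v \<in> U"
    by (auto simp: eventually_at_right_field)
  have "z + t *\<^sub>R v \<in> U \<inter> K" if "0 \<le> t" "t < e" for t
    using e(2)[of t] assms that by (cases "t = 0") (auto simp: model_spaces_def)
  with e(1) show ?thesis using that by blast
qed

text \<open>
  The horizontal subspace orthogonal to the last half-space coordinate has one dimension less than
  the parameter space. This is the obstruction behind both the failure of \<open>C\<^sup>2\<close> regularity and the
  presence of a boundary at the points of minimal height.
\<close>

lemma no_injective_linear_into_horizontal:
  fixes D :: "'a::euclidean_space \<times> real \<Rightarrow> 'a hyp_line"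
  assumes "linear D" "inj D"
  shows "\<exists>v. snd (fst (D v)) \<noteq> 0 \<or> snd (D v) \<noteq> 0"
proof (rule ccontr)
  assume "\<not> ?thesis"
  then have 0: "snd (fst (D v)) = 0" "snd (D v) = 0" for v by blast+
  have "linear (fst \<circ> fst \<circ> D)"
    by (intro linear_compose assms linear_fst)
  moreover have "inj (fst \<circ> fst \<circ> D)"
  proof (rule injI)
    fix v w assume "(fst \<circ> fst \<circ> D) v = (fst \<circ> fst \<circ> D) w"
    then have "D v = D w" using 0[of v] 0[of w] by (simp add: prod_eq_iff)
    then show "v = w" using assms(2) by (simp add: inj_eq)
  qed
  ultimately have "DIM('a \<times> real) \<le> DIM('a)"
    using linear_injective_imp_surjective
    by (metis dim_UNIV dim_image_eq dim_subset_UNIV inj_on_subset subset_UNIV)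
  then show False by simp
qed

section \<open>The half-space model\<close>

lemma riem_metric_nondegenerate:
  assumes y: "snd (fst p) \<noteq> 0" and eq: "\<And>z. riem_metric p v z = riem_metric p w z"
  shows "v = w"
proof -
  have *: "riem_metric p (v - w) z = 0" for z
    using eq[of z] by (simp add: riem_metric_def inner_diff_left algebra_simps diff_divide_distrib)
  have "fst (v - w) \<bullet> fst (v - w) / (snd (fst p))\<^sup>2 + snd (v - w) * snd (v - w) = 0"
    using *[of "v - w"] by (simp add: riem_metric_def)
  moreover have "0 \<le> fst (v - w) \<bullet> fst (v - w) / (snd (fst p))\<^sup>2" by simp
  moreover have "0 \<le> snd (v - w) * snd (v - w)" by simp
  ultimately have "fst (v - w) \<bullet> fst (v - w) / (snd (fst p))\<^sup>2 = 0" "snd (v - w) * snd (v - w) = 0"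
    by linarith+
  then have "fst (v - w) = 0" "snd (v - w) = 0" using y by simp_all
  then show ?thesis by (simp add: prod_eq_iff)
qed

text \<open>
  The Koszul formula for the conformally flat metric of the half-space; the \<open>\<real>\<close> factor is flat and
  does not contribute.
\<close>

lemma christoffel_half_space:
  fixes p u v :: "'a::euclidean_space hyp_line"
  assumes y: "snd (fst p) \<noteq> 0"
  shows "christoffel p u v =
    ((1 / snd (fst p)) *\<^sub>R ((0, fst u \<bullet> fst v) - snd (fst u) *\<^sub>R fst v - snd (fst v) *\<^sub>R fst u), 0)"
    (is "_ = ?w")
proof -
  let ?y = "snd (fst p)"
  have D: "frechet_derivative (\<lambda>q. riem_metric q a b) (at p) =
      (\<lambda>h. - 2 * (fst a \<bullet> fst b) * snd (fst h) / ?y ^ 3)" for a b :: "'a hyp_line"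
    unfolding riem_metric_def
    by (rule frechet_derivative_eqI)
       (use y in \<open>auto intro!: derivative_eq_intros ext simp: field_simps eval_nat_numeral\<close>)
  have eq: "2 * riem_metric p ?w z = frechet_derivative (\<lambda>q. riem_metric q v z) (at p) u
     + frechet_derivative (\<lambda>q. riem_metric q u z) (at p) v
     - frechet_derivative (\<lambda>q. riem_metric q u v) (at p) z" for z
    unfolding D using y
    by (simp add: riem_metric_def inner_prod_def inner_simps algebra_simps)
       (simp add: field_simps eval_nat_numeral)
  show ?thesis unfolding christoffel_def
  proof (rule the_equality)
    fix w
    assume w: "\<forall>z. 2 * riem_metric p w z = frechet_derivative (\<lambda>q. riem_metric q v z) (at p) u
     + frechet_derivative (\<lambda>q. riem_metric q u z) (at p) v
     - frechet_derivative (\<lambda>q. riem_metric q u v) (at p) z"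
    show "w = ?w"
    proof (rule riem_metric_nondegenerate[OF y])
      fix z show "riem_metric p w z = riem_metric p ?w z"
        using w[rule_format, of z] eq[of z] by linarith
    qed
  qed (use eq in blast)
qed

text \<open>
  The logarithm of the last coordinate is the signed distance to a horosphere: it does not increase
  distances, and is an isometry on the geodesics orthogonal to the horospheres. Asymptotic statements
  thus reduce to statements about \<open>s = ln y\<close>. The computation rests on
  \<open>(y\<^sup>2 + y'\<^sup>2) / (2 y y') = cosh (ln y - ln y')\<close>.
\<close>

lemma
  assumes "0 < snd z" "0 < snd w"
  shows hyp_dist_ge_level_gap: "\<bar>ln (snd z) - ln (snd w)\<bar> \<le> hyp_dist z w"
    and hyp_dist_vertical: "fst z = fst w \<Longrightarrow> hyp_dist z w = \<bar>ln (snd z) - ln (snd w)\<bar>"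
proof -
  let ?r = "\<bar>ln (snd z) - ln (snd w)\<bar>"
  have c: "1 + (snd z - snd w)\<^sup>2 / (2 * snd z * snd w) = cosh ?r"
    using assms
    by (simp add: cosh_def exp_diff exp_minus abs_if) (simp add: field_simps power2_eq_square)
  have d: "(dist z w)\<^sup>2 = (dist (fst z) (fst w))\<^sup>2 + (snd z - snd w)\<^sup>2"
    by (simp add: dist_prod_def dist_real_def)
  have "cosh ?r \<le> 1 + (dist z w)\<^sup>2 / (2 * snd z * snd w)"
    unfolding c[symmetric] d using assms by (intro add_left_mono divide_right_mono) auto
  then have "arcosh (cosh ?r) \<le> hyp_dist z w"
    unfolding hyp_dist_def
    using arcosh_real_strict_mono[of "cosh ?r" "1 + (dist z w)\<^sup>2 / (2 * snd z * snd w)"]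
    by (cases "cosh ?r = 1 + (dist z w)\<^sup>2 / (2 * snd z * snd w)") (auto simp: cosh_real_ge_1)
  then show "?r \<le> hyp_dist z w" by (simp only: arcosh_cosh_real abs_ge_zero)
  show "hyp_dist z w = ?r" if "fst z = fst w"
  proof -
    have "hyp_dist z w = arcosh (cosh ?r)" unfolding hyp_dist_def d c[symmetric] using that by simp
    then show ?thesis by (simp only: arcosh_cosh_real abs_ge_zero)
  qed
qed

lemma horosphere_None: "horosphere None c = {z. 0 < snd z \<and> ln (snd z) = c}"
  by (auto simp: horosphere_def hyp_def horo_level_def)

lemma horo_region_None:
  assumes "a < b" shows "horo_region None a b = {z. snd z \<in> {exp a<..<exp b}}"
proof -
  have "0 < y \<and> a < ln y \<and> ln y < b \<longleftrightarrow> exp a < y \<and> y < exp b" for y :: real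
    using ln_less_cancel_iff[of y "exp b"] ln_less_cancel_iff[of "exp a" y] less_trans[OF exp_gt_zero, of a y]
    by auto
  then show ?thesis using assms by (auto simp: horo_region_def hyp_def horo_level_def)
qed

lemma tangent_space_slice:
  fixes p :: "'a::euclidean_space hyp_line"
  assumes p: "p \<in> hyp \<times> {t}"
  shows "tangent_space (hyp \<times> {t}) p = {v. snd v = 0}"
proof
  show "tangent_space (hyp \<times> {t}) p \<subseteq> {v. snd v = 0}"
    unfolding tangent_space_def
  proof (rule span_minimal, clarify)
    fix v :: "'a hyp_line" and c e
    assume c: "0 < (e::real)" "c ` {0..<e} \<subseteq> hyp \<times> {t}"
      "(c has_vector_derivative v) (at 0 within {0..<e})" and "p = c 0"
    have "((\<lambda>t. snd (c t)) has_vector_derivative snd v) (at 0 within {0..<e})"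
      by (rule bounded_linear.has_vector_derivative[OF bounded_linear_snd c(3)])
    moreover have "((\<lambda>t. snd (c t)) has_vector_derivative 0) (at 0 within {0..<e})"
      by (rule has_vector_derivative_transform[OF _ _ has_vector_derivative_const[of t]])
         (use c(1,2) in \<open>fastforce+\<close>)
    ultimately show "snd v = 0"
      using vector_derivative_unique_within at_within_Ico_nontrivial[of 0 e] c(1) by blast
  qed (auto simp: subspace_def)
  show "{v. snd v = 0} \<subseteq> tangent_space (hyp \<times> {t}) p"
  proof
    fix v :: "'a hyp_line" assume v: "v \<in> {v. snd v = 0}"
    define y where "y = snd (fst p)"
    define e where "e = y / (\<bar>snd (fst v)\<bar> + 1)"
    have y: "0 < y" using p by (auto simp: hyp_def y_def)
    have in_slice: "p + s *\<^sub>R v \<in> hyp \<times> {t}" if "0 \<le> s" "s < e" for s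
    proof -
      have "- (s * snd (fst v)) \<le> s * \<bar>snd (fst v)\<bar>" using that
        by (metis abs_ge_minus_self abs_mult abs_of_nonneg)
      also have "\<dots> \<le> s * (\<bar>snd (fst v)\<bar> + 1)" using that by (simp add: mult_left_mono)
      also have "\<dots> < y" using that by (simp add: e_def pos_less_divide_eq)
      finally show ?thesis using v p by (simp add: hyp_def y_def mem_Times_iff)
    qed
    have "((\<lambda>s. p + s *\<^sub>R v) has_vector_derivative v) (at 0 within {0..<e})"
      by (auto intro!: derivative_eq_intros simp: has_vector_derivative_def)
    moreover have "0 < e" using y by (simp add: e_def)
    moreover have "(\<lambda>s. p + s *\<^sub>R v) ` {0..<e} \<subseteq> hyp \<times> {t}"
      using in_slice by (intro image_subsetI) auto
    ultimately show "v \<in> tangent_space (hyp \<times> {t}) p"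
      unfolding tangent_space_def
      by (intro span_base CollectI exI[of _ "\<lambda>s. p + s *\<^sub>R v"] exI[of _ e]) simp
  qed
qed

section \<open>The profile curve\<close>

text \<open>
  The properties of a solution \<open>\<theta>\<close> of \<open>\<bar>sin \<theta>\<bar> ^ m \<theta>' = 1\<close>, \<open>\<theta> 0 = 0\<close>, and of its profile
  \<open>\<phi>\<close>, on which everything geometric depends. The assumption \<open>angle_steep\<close> is an integrated form of
  the equation that keeps its meaning at \<open>s = 0\<close>: as \<open>\<theta>\<close> is continuous, it says that the slope
  \<open>tan (\<theta> s)\<close> is infinitely large compared with \<open>s\<close> there.
\<close>

locale reaper_profile =
  fixes m :: nat and L :: real and \<theta> \<phi> :: "real \<Rightarrow> real"
  assumes m_pos: "0 < m" and L_pos: "0 < L"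
    and angle_bound: "\<bar>s\<bar> < L \<Longrightarrow> \<bar>\<theta> s\<bar> < pi / 2"
    and angle_odd: "\<bar>s\<bar> < L \<Longrightarrow> \<theta> (- s) = - \<theta> s"
    and angle_pos: "0 < s \<Longrightarrow> s < L \<Longrightarrow> 0 < \<theta> s"
    and angle_cont: "\<bar>s\<bar> < L \<Longrightarrow> isCont \<theta> s"
    and angle_deriv: "\<bar>s\<bar> < L \<Longrightarrow> s \<noteq> 0 \<Longrightarrow>
          (\<theta> has_real_derivative 1 / \<bar>sin (\<theta> s)\<bar> ^ m) (at s)"
    and angle_steep: "\<bar>s\<bar> < L \<Longrightarrow> \<bar>s\<bar> \<le> \<bar>\<theta> s\<bar> * \<bar>tan (\<theta> s)\<bar>"
    and profile_zero: "\<phi> 0 = 0"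
    and profile_deriv: "\<bar>s\<bar> < L \<Longrightarrow> (\<phi> has_real_derivative tan (\<theta> s)) (at s)"
    and profile_unbounded: "\<exists>s. 0 < s \<and> s < L \<and> h < \<phi> s"

text \<open>
  The antiderivative of \<open>\<bar>sin\<bar> ^ m\<close>, to be inverted. Strict monotonicity survives the zero of the
  derivative at 0, and oddness carries it over to negative arguments.
\<close>

lemma arc_function_exists:
  obtains F :: "real \<Rightarrow> real"
  where "\<And>x. (F has_real_derivative \<bar>sin x\<bar> ^ m) (at x)" "\<And>x. F (- x) = - F x"
    "\<And>x y. 0 \<le> x \<Longrightarrow> x < y \<Longrightarrow> y \<le> pi / 2 \<Longrightarrow> F x < F y"
proof -
  obtain G where "\<forall>x. - \<infinity> < ereal x \<longrightarrow> ereal x < \<infinity> \<longrightarrow>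
      (G has_vector_derivative \<bar>sin x\<bar> ^ m) (at x)"
    using einterval_antiderivative[of "-\<infinity>" "\<infinity>" "\<lambda>x. \<bar>sin x\<bar> ^ m"]
    by (force intro!: continuous_intros)
  then have G: "(G has_real_derivative \<bar>sin x\<bar> ^ m) (at x)" for x
    by (simp add: has_real_derivative_iff_has_vector_derivative)
  define F where "F x = G x - G 0" for x
  have F: "(F has_real_derivative \<bar>sin x\<bar> ^ m) (at x)" for x
    unfolding F_def using G by (auto intro!: derivative_eq_intros)
  have "((\<lambda>x. F x + F (- x)) has_real_derivative 0) (at x)" for x
    by (auto intro!: derivative_eq_intros F DERIV_chain2[where f=F])
  then have "F x + F (- x) = F 0 + F (- 0)" for x
    using DERIV_isconst_all[of "\<lambda>x. F x + F (- x)"] by blast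
  then have odd: "F (- x) = - F x" for x
    by (metis F_def add.right_neutral add_eq_0_iff diff_self minus_zero)
  have "F x < F y" if "0 \<le> x" "x < y" "y \<le> pi / 2" for x y
  proof -
    obtain z where z: "x < z" "z < y" "F y - F x = (y - x) * \<bar>sin z\<bar> ^ m"
      using MVT2[OF \<open>x < y\<close>, of F "\<lambda>x. \<bar>sin x\<bar> ^ m"] F by blast
    have "0 < sin z" using z that by (intro sin_gt_zero) auto
    with z that have "0 < F y - F x" by (simp add: zero_less_power)
    then show ?thesis by simp
  qed
  with that F odd show ?thesis by blast
qed

text \<open>
  Take for \<open>\<theta>\<close> the inverse of the antiderivative \<open>F\<close> of \<open>\<bar>sin\<bar> ^ m\<close>. It is continuous by compactness of \<open>[- pi / 2, pi / 2]\<close>, and is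
  differentiable where \<open>F'\<close> does not vanish. Unboundedness of the height comes from
  \<open>(\<phi> \<circ> F)' = tan * \<bar>sin\<bar> ^ m\<close>, which for angles in \<open>[pi / 4, pi / 2)\<close> is at least a positive
  multiple of \<open>tan\<close>, the derivative of \<open>- ln \<circ> cos\<close>.
\<close>

lemma reaper_profile_exists:
  assumes m: "0 < m"
  shows "\<exists>L \<theta> \<phi>. reaper_profile m L \<theta> \<phi>"
proof -
  obtain F where F: "\<And>x. (F has_real_derivative \<bar>sin x\<bar> ^ m) (at x)"
    and odd: "\<And>x. F (- x) = - F x"
    and mono0: "\<And>x y. 0 \<le> x \<Longrightarrow> x < y \<Longrightarrow> y \<le> pi / 2 \<Longrightarrow> F x < F y"
    by (rule arc_function_exists[of m]) blast
  have F0: "F 0 = 0" using odd[of 0] by simp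
  define I where "I = {- (pi/2)..pi/2}"
  define L where "L = F (pi / 2)"
  have mono: "F x < F y" if "x \<in> I" "y \<in> I" "x < y" for x y
  proof -
    consider "0 \<le> x" | "y \<le> 0" | "x < 0" "0 < y" by linarith
    then show ?thesis
    proof cases
      case 1 with that show ?thesis by (intro mono0) (auto simp: I_def)
    next
      case 2
      have "F (- y) < F (- x)" using 2 that by (intro mono0) (auto simp: I_def)
      then show ?thesis by (simp add: odd)
    next
      case 3
      have "F 0 < F (- x)" "F 0 < F y" using 3 that by (intro mono0; auto simp: I_def)+
      then show ?thesis by (simp add: odd F0)
    qed
  qed
  have L: "0 < L" using mono0[of 0 "pi/2"] by (simp add: L_def F0)
  have contF: "continuous_on X F" for X
    using F by (meson DERIV_isCont continuous_at_imp_continuous_on)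
  have inj: "inj_on F I"
    by (rule inj_onI) (metis mono linorder_neqE_linordered_idom order_less_irrefl)
  have img: "F ` I = {-L..L}"
  proof
    have mono_le: "F x \<le> F y" if "x \<in> I" "y \<in> I" "x \<le> y" for x y
      using mono[of x y] that by (cases "x = y") auto
    have "- L \<le> F x \<and> F x \<le> L" if "x \<in> I" for x
      using that mono_le[of x "pi/2"] mono_le[of "-(pi/2)" x] odd[of "pi/2"]
      by (simp add: I_def L_def)
    then show "F ` I \<subseteq> {-L..L}" by auto
    show "{-L..L} \<subseteq> F ` I"
    proof
      fix y assume "y \<in> {-L..L}"
      then have "\<exists>x\<ge>-(pi/2). x \<le> pi/2 \<and> F x = y"
        by (intro IVT') (auto simp: odd L_def contF)
      then show "y \<in> F ` I" by (auto simp: I_def)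
    qed
  qed
  define T where "T = inv_into I F"
  have TF: "T (F x) = x" if "x \<in> I" for x using inj that by (simp add: T_def)
  have FT: "F (T s) = s" if "\<bar>s\<bar> \<le> L" for s
    using that img f_inv_into_f[of s F I] by (auto simp: T_def abs_le_iff)
  have TI: "T s \<in> I" if "\<bar>s\<bar> \<le> L" for s
    using that img inv_into_into[of s F I] by (auto simp: T_def abs_le_iff)
  have "continuous_on (F ` I) T"
    by (rule continuous_on_inv) (auto simp: contF I_def TF)
  then have contT: "isCont T s" if "\<bar>s\<bar> < L" for s
    using that continuous_on_interior[of "{-L..L}" T s] by (auto simp: img abs_less_iff)
  have T_bound: "\<bar>T s\<bar> < pi / 2" if "\<bar>s\<bar> < L" for s
  proof -
    have "F (- (pi/2)) = - L" using odd[of "pi/2"] by (simp only: L_def)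
    then have "T s \<noteq> pi / 2" "T s \<noteq> - (pi / 2)"
      using FT[of s] that L_def by (metis abs_ge_self abs_minus_cancel less_le_not_le order_less_imp_le)+
    then show ?thesis using TI[of s] that by (auto simp: I_def)
  qed
  have T_odd: "T (- s) = - T s" if "\<bar>s\<bar> < L" for s
  proof -
    have "- T s \<in> I" using TI[of s] that by (auto simp: I_def)
    from TF[OF this] show ?thesis using FT[of s] that by (simp add: odd)
  qed
  have T_pos: "0 < T s" if "0 < s" "s < L" for s
  proof (rule ccontr)
    assume "\<not> 0 < T s"
    then have "F (T s) \<le> F 0"
      using mono[of "T s" 0] TI[of s] that by (cases "T s = 0") (auto simp: I_def)
    then show False using FT[of s] that F0 by simp
  qed
  have T0: "T 0 = 0" using TF[of 0] F0 by (simp add: I_def)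
  have T_nz: "sin (T s) \<noteq> 0" if "\<bar>s\<bar> < L" "s \<noteq> 0" for s
  proof -
    have "T s \<noteq> 0" using FT[of s] F0 that by auto
    then show ?thesis using T_bound[OF that(1)] sin_gt_zero[of "T s"] sin_gt_zero[of "- T s"]
      by (cases "T s > 0") auto
  qed
  have T_deriv: "(T has_real_derivative 1 / \<bar>sin (T s)\<bar> ^ m) (at s)" if "\<bar>s\<bar> < L" "s \<noteq> 0" for s
  proof -
    have "(T has_real_derivative inverse (\<bar>sin (T s)\<bar> ^ m)) (at s)"
      by (rule DERIV_inverse_function[where f=F and a="-L" and b=L])
         (use F that T_nz contT FT in auto)
    then show ?thesis by (simp add: field_simps)
  qed
  have steep: "\<bar>s\<bar> \<le> \<bar>T s\<bar> * \<bar>tan (T s)\<bar>" if "0 \<le> s" "s < L" for s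
  proof (cases "s = 0")
    case False
    then have s: "0 < T s" "T s < pi / 2" using T_pos[of s] T_bound[of s] that by auto
    obtain z where z: "0 < z" "z < T s" "F (T s) - F 0 = (T s - 0) * \<bar>sin z\<bar> ^ m"
      using MVT2[OF s(1), of F "\<lambda>x. \<bar>sin x\<bar> ^ m"] F by blast
    have sz: "0 < sin z" "sin z \<le> sin (T s)"
      using z s by (auto intro!: sin_gt_zero simp: sin_mono_le_eq)
    have "\<bar>sin z\<bar> ^ m \<le> \<bar>sin z\<bar> ^ 1" using m sz by (intro power_decreasing) auto
    also have "\<dots> \<le> sin (T s)" using sz by simp
    also have "\<dots> \<le> tan (T s)"
      using s sz cos_gt_zero[of "T s"] cos_le_one[of "T s"]
      by (simp add: tan_def pos_le_divide_eq mult_left_le)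
    finally have "F (T s) \<le> T s * tan (T s)" using z s F0 by (simp add: mult_left_mono)
    then show ?thesis using FT[of s] that s tan_gt_zero[of "T s"] by simp
  qed (simp add: T0)
  obtain \<phi>0 where "\<forall>s. ereal (-L) < ereal s \<longrightarrow> ereal s < ereal L \<longrightarrow>
      (\<phi>0 has_vector_derivative tan (T s)) (at s)"
  proof -
    have "isCont (\<lambda>s. tan (T s)) s" if "ereal (-L) < ereal s" "ereal s < ereal L" for s
    proof -
      have "\<bar>s\<bar> < L" using that by auto
      then have "isCont T s" "\<bar>T s\<bar> < pi / 2" using contT T_bound by auto
      moreover have "0 < cos (T s)"
        using \<open>\<bar>T s\<bar> < pi / 2\<close> by (intro cos_gt_zero_pi) linarith+
      ultimately show ?thesis by (intro isCont_tan') auto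
    qed
    then show ?thesis using einterval_antiderivative[of "-L" L "\<lambda>s. tan (T s)"] L that by force
  qed
  then have \<phi>0: "(\<phi>0 has_real_derivative tan (T s)) (at s)" if "\<bar>s\<bar> < L" for s
    using that by (auto simp: has_real_derivative_iff_has_vector_derivative)
  define \<phi> where "\<phi> s = \<phi>0 s - \<phi>0 0" for s
  have \<phi>: "(\<phi> has_real_derivative tan (T s)) (at s)" if "\<bar>s\<bar> < L" for s
    unfolding \<phi>_def using \<phi>0[OF that] by (auto intro!: derivative_eq_intros)
  have unb: "\<exists>s. 0 < s \<and> s < L \<and> h < \<phi> s" for h
  proof -
    define c where "c = sin (pi/4) ^ m"
    have c: "0 < c" by (simp add: c_def sin_gt_zero)
    have F_in: "0 < F t \<and> F t < L" if "0 < t" "t < pi/2" for t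
      using mono0[of 0 t] mono0[of t "pi/2"] that F0 by (simp add: L_def)
    (* Monotonicity of A is the lower bound of the height by a multiple of - ln (cos t). *)
    define A where "A t = \<phi> (F t) + c * ln (cos t)" for t
    have incr: "A (pi/4) \<le> A t" if t: "pi/4 \<le> t" "t < pi/2" for t
    proof (rule DERIV_nonneg_imp_nondecreasing[OF t(1)])
      fix x assume x: "pi/4 \<le> x" "x \<le> t"
      then have x': "0 < x" "x < pi/2" using t pi_gt_zero by linarith+
      have cx: "0 < cos x" using x' by (intro cos_gt_zero)
      have sx: "0 < sin x" using x' by (intro sin_gt_zero) auto
      have "((\<lambda>t. \<phi> (F t)) has_real_derivative tan (T (F x)) * \<bar>sin x\<bar> ^ m) (at x)"
        using F_in[OF x'] by (intro DERIV_chain2[where f=\<phi>] F \<phi>) auto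
      then have "(A has_real_derivative tan (T (F x)) * \<bar>sin x\<bar> ^ m + c * (inverse (cos x) * - sin x)) (at x)"
        unfolding A_def using cx by (auto intro!: derivative_eq_intros simp: field_simps)
      also have "tan (T (F x)) * \<bar>sin x\<bar> ^ m + c * (inverse (cos x) * - sin x) = tan x * (sin x ^ m - c)"
      proof -
        have "T (F x) = x" using x' by (intro TF) (auto simp: I_def)
        moreover have "tan x = sin x * inverse (cos x)" by (simp add: tan_def divide_inverse)
        ultimately show ?thesis using sx by (simp add: right_diff_distrib)
      qed
      finally have *: "(A has_real_derivative tan x * (sin x ^ m - c)) (at x)" .
      have "sin (pi/4) \<le> sin x" using x x' by (subst sin_mono_le_eq) auto
      then have "c \<le> sin x ^ m" unfolding c_def by (intro power_mono) (auto intro: sin_ge_zero)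
      then have "0 \<le> tan x * (sin x ^ m - c)" using tan_gt_zero[OF x'] by simp
      with * show "\<exists>y. (A has_real_derivative y) (at x) \<and> 0 \<le> y" by blast
    qed
    (* An angle t with - ln (cos t) = K: the first bound puts it above pi / 4, the second one
       makes the height exceed h. *)
    define K where "K = max (- ln (cos (pi/4))) ((h - A (pi/4)) / c + 1)"
    define t where "t = arccos (exp (- K))"
    have c4: "0 < cos (pi/4)" by (intro cos_gt_zero) auto
    have e: "exp (- K) \<le> cos (pi/4)"
      using c4 unfolding K_def by (simp add: ln_ge_iff[symmetric])
    then have e1: "exp (- K) < 1"
      using cos_monotone_0_pi[of 0 "pi/4"] by (intro le_less_trans[OF e]) auto
    have t1: "cos t = exp (- K)" using e1
      by (auto simp: t_def intro!: cos_arccos intro: order_trans[of _ 0] order_less_imp_le)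
    have t2: "t < pi/2" "0 \<le> t"
      using arccos_less_arccos[of 0 "exp (- K)"] e1 
      by (auto simp: t_def intro!: arccos_lbound intro: order_trans[of _ 0] order_less_imp_le)
    have t3: "pi/4 \<le> t" 
      
      using e arccos_le_arccos[of "exp (-K)" "cos (pi/4)"] order_trans[of "-1" 0 "exp (-K)"]
      by (simp add: t_def arccos_cos)
    have "A (pi/4) \<le> \<phi> (F t) - c * K" using incr[OF t3 t2(1)] t1 by (simp add: A_def)
    moreover have "h - A (pi/4) < c * K"
    proof -
      have "(h - A (pi/4)) / c < K" by (simp add: K_def)
      then show ?thesis using c by (simp add: field_simps)
    qed
    ultimately have "h < \<phi> (F t)" by linarith
    moreover have "0 < t" using t3 pi_gt_zero by linarith
    ultimately show ?thesis using F_in[of t] t2 by blast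
  qed
  have "reaper_profile m L T \<phi>"
  proof
    fix s assume s: "\<bar>s\<bar> < L"
    show "\<bar>s\<bar> \<le> \<bar>T s\<bar> * \<bar>tan (T s)\<bar>"
      using steep[of s] steep[of "- s"] T_odd[OF s] s by (cases "0 \<le> s") auto
  qed (use m L T_bound T_odd T_pos contT T_deriv \<phi> unb in \<open>auto simp: \<phi>_def\<close>)
  then show ?thesis by blast
qed

context reaper_profile
begin

lemma angle_zero [simp]: "\<theta> 0 = 0"
  using angle_odd[of 0] L_pos by simp

lemma cos_angle_pos: "\<bar>s\<bar> < L \<Longrightarrow> 0 < cos (\<theta> s)"
  using angle_bound[of s] by (intro cos_gt_zero_pi) auto

lemma sin_angle_pos: "0 < s \<Longrightarrow> s < L \<Longrightarrow> 0 < sin (\<theta> s)"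
  using angle_bound[of s] angle_pos[of s] by (intro sin_gt_zero) auto

lemma sin_angle_nonzero: "\<bar>s\<bar> < L \<Longrightarrow> s \<noteq> 0 \<Longrightarrow> sin (\<theta> s) \<noteq> 0"
  using sin_angle_pos[of s] sin_angle_pos[of "- s"] angle_odd[of s] by (cases "s > 0") auto

lemma tan_angle_pos: "0 < s \<Longrightarrow> s < L \<Longrightarrow> 0 < tan (\<theta> s)"
  using angle_bound[of s] angle_pos[of s] by (intro tan_gt_zero) auto

lemma tan_angle_cont: "\<bar>s\<bar> < L \<Longrightarrow> isCont (\<lambda>s. tan (\<theta> s)) s"
  using cos_angle_pos[of s] angle_cont[of s] by (intro isCont_tan') auto

lemma tan_angle_deriv:
  assumes "\<bar>s\<bar> < L" "s \<noteq> 0"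
  shows "((\<lambda>s. tan (\<theta> s)) has_real_derivative
           inverse ((cos (\<theta> s))\<^sup>2) * (1 / \<bar>sin (\<theta> s)\<bar> ^ m)) (at s)"
  using cos_angle_pos[of s] angle_deriv[of s] assms
  by (intro DERIV_chain2[where f=tan] DERIV_tan) auto

text \<open>
  The quotient \<open>tan (\<theta> s) / s\<close> tends to infinity, that is, \<open>\<phi>\<close> has infinite second derivative at
  0. The reciprocal is used because its value at 0, where the division is by zero, is the limit.
\<close>

lemma inverse_slope_ratio_cont: "isCont (\<lambda>s. s / tan (\<theta> s)) 0"
proof -
  have "\<forall>\<^sub>F s in at 0. \<bar>s\<bar> < L"
    using L_pos by (auto simp: eventually_at dist_real_def)
  then have "\<forall>\<^sub>F s in at 0. norm (s / tan (\<theta> s)) \<le> \<bar>\<theta> s\<bar>"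
  proof eventually_elim
    case (elim s)
    then show ?case using angle_steep[of s]
      by (cases "tan (\<theta> s) = 0") (auto simp: field_simps)
  qed
  moreover have "((\<lambda>s. \<bar>\<theta> s\<bar>) \<longlongrightarrow> 0) (at 0)"
    using angle_cont[of 0] L_pos by (auto simp: isCont_def intro: tendsto_rabs_zero)
  ultimately show ?thesis
    unfolding isCont_def by (simp add: Lim_null_comparison)
qed

lemma profile_cont: "\<bar>s\<bar> < L \<Longrightarrow> isCont \<phi> s"
  using profile_deriv DERIV_isCont by blast

lemma profile_even: assumes "\<bar>s\<bar> < L" shows "\<phi> (- s) = \<phi> s"
proof -
  have "((\<lambda>s. \<phi> s - \<phi> (- s)) has_real_derivative 0) (at t within {-L<..<L})" if "t \<in> {-L<..<L}" for t
  proof -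
    have t: "\<bar>t\<bar> < L" using that by auto
    have "((\<lambda>s. \<phi> s - \<phi> (- s)) has_real_derivative tan (\<theta> t) - tan (\<theta> (- t)) * (-1)) (at t)"
      using t by (intro derivative_intros DERIV_chain2[where f=\<phi>] profile_deriv)
        (auto intro!: derivative_eq_intros)
    then show ?thesis using angle_odd[OF t] by (simp add: has_field_derivative_at_within)
  qed
  then obtain c where c: "\<And>t. t \<in> {-L<..<L} \<Longrightarrow> \<phi> t - \<phi> (- t) = c"
    using has_field_derivative_zero_constant[of "{-L<..<L}" "\<lambda>s. \<phi> s - \<phi> (- s)"] by auto
  have "0 \<in> {-L<..<L}" "s \<in> {-L<..<L}" using L_pos assms by auto
  from c[OF this(1)] c[OF this(2)] show ?thesis by simp
qed

lemma profile_abs: "\<bar>s\<bar> < L \<Longrightarrow> \<phi> \<bar>s\<bar> = \<phi> s"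
  using profile_even[of s] by (cases "s \<ge> 0") auto

lemma profile_less:
  assumes "\<bar>s\<bar> < L" "\<bar>t\<bar> < L" shows "\<phi> s < \<phi> t \<longleftrightarrow> \<bar>s\<bar> < \<bar>t\<bar>"
proof -
  have "\<phi> a < \<phi> b" if "0 \<le> a" "a < b" "b < L" for a b
  proof (rule DERIV_pos_imp_increasing_open[OF that(2)])
    show "\<exists>y. (\<phi> has_real_derivative y) (at x) \<and> 0 < y" if "a < x" "x < b" for x
      using that \<open>0 \<le> a\<close> \<open>b < L\<close>
      by (intro exI[of _ "tan (\<theta> x)"] conjI profile_deriv tan_angle_pos) auto
    show "continuous_on {a..b} \<phi>"
      using that by (intro continuous_at_imp_continuous_on ballI profile_cont) auto
  qed
  from this[of "\<bar>s\<bar>" "\<bar>t\<bar>"] this[of "\<bar>t\<bar>" "\<bar>s\<bar>"] show ?thesis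
    using assms profile_abs[of s] profile_abs[of t] by (cases "\<bar>s\<bar>" "\<bar>t\<bar>" rule: linorder_cases) auto
qed

lemma profile_pos: "\<bar>s\<bar> < L \<Longrightarrow> s \<noteq> 0 \<Longrightarrow> 0 < \<phi> s"
  using profile_less[of 0 s] L_pos profile_zero by simp

end

section \<open>Parabolic graphs and their parametrization\<close>

context reaper_profile
begin

definition surf :: "real set \<Rightarrow> 'a::euclidean_space hyp_line set" where
  "surf J = {p. 0 < snd (fst p) \<and> ln (snd (fst p)) \<in> J \<and> snd p = \<phi> (ln (snd (fst p)))}"

text \<open>
  Curves are allowed to be one-sided, as needed at boundary points.
\<close>

lemma surf_velocity:
  fixes c :: "real \<Rightarrow> 'a::euclidean_space hyp_line"
  assumes J: "J \<subseteq> {-L<..<L}" and a: "a \<in> T" "at a within T \<noteq> bot" and c: "c ` T \<subseteq> surf J"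
    and v: "(c has_vector_derivative v) (at a within T)"
  shows "snd v = tan (\<theta> (ln (snd (fst (c a))))) * (snd (fst v) / snd (fst (c a)))"
proof -
  have y: "0 < snd (fst (c a))" "\<bar>ln (snd (fst (c a)))\<bar> < L"
    using a c J by (fastforce simp: surf_def)+
  have 1: "((\<lambda>t. snd (fst (c t))) has_real_derivative snd (fst v)) (at a within T)"
    unfolding has_real_derivative_iff_has_vector_derivative
    by (intro bounded_linear.has_vector_derivative[OF bounded_linear_snd]
        bounded_linear.has_vector_derivative[OF bounded_linear_fst] v)
  have 2: "((\<lambda>t. snd (c t)) has_real_derivative snd v) (at a within T)"
    unfolding has_real_derivative_iff_has_vector_derivative
    by (intro bounded_linear.has_vector_derivative[OF bounded_linear_snd] v)
  have "((\<lambda>t. \<phi> (ln (snd (fst (c t))))) has_real_derivative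
      tan (\<theta> (ln (snd (fst (c a))))) * (1 / snd (fst (c a)) * snd (fst v))) (at a within T)"
    using y by (intro DERIV_chain2[where f=\<phi>] DERIV_chain2[where f=ln] 1 profile_deriv)
       (auto intro!: derivative_eq_intros)
  then have "((\<lambda>t. snd (c t)) has_real_derivative
      tan (\<theta> (ln (snd (fst (c a))))) * (1 / snd (fst (c a)) * snd (fst v))) (at a within T)"
    by (rule has_field_derivative_transform_within[OF _ zero_less_one a(1)])
       (use c in \<open>force simp: surf_def\<close>)
  then show ?thesis
    using vector_derivative_unique_within[OF a(2)] 2
    by (fastforce simp: has_real_derivative_iff_has_vector_derivative)
qed

text \<open>
  A single parametrization for the surfaces over all intervals. Near a boundary point it is
  restricted to a half-space, but it is \<open>C\<^sup>1\<close> on a full neighbourhood.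
\<close>

definition chart :: "'a::euclidean_space \<times> real \<Rightarrow> 'a hyp_line" where
  "chart z = ((fst z, exp (snd z)), \<phi> (snd z))"

lemma chart_deriv:
  assumes "\<bar>snd z\<bar> < L"
  shows "(chart has_derivative (\<lambda>v. ((fst v, exp (snd z) * snd v), tan (\<theta> (snd z)) * snd v))) (at z)"
  unfolding chart_def
  by (intro has_derivative_Pair has_derivative_fst has_derivative_ident has_derivative_comp_snd
      DERIV_exp profile_deriv assms)

lemma open_tube: assumes "open I"
  shows "open {p :: 'a::euclidean_space hyp_line. 0 < snd (fst p) \<and> ln (snd (fst p)) \<in> I}"
proof -
  have "open {p :: 'a hyp_line. 0 < snd (fst p)}"
    by (intro open_Collect_less continuous_intros)
  moreover have "continuous_on {p :: 'a hyp_line. 0 < snd (fst p)} (\<lambda>p. ln (snd (fst p)))"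
    by (intro continuous_intros) auto
  ultimately have "open ({p :: 'a hyp_line. 0 < snd (fst p)} \<inter> (\<lambda>p. ln (snd (fst p))) -` I)"
    using continuous_open_preimage assms by blast
  then show ?thesis by (simp add: vimage_def Int_def)
qed

lemma chart_C1:
  assumes I: "open I" "I \<subseteq> {-L<..<L}"
  shows "Ck_on 1 (chart :: 'a::euclidean_space \<times> real \<Rightarrow> _) {z. snd z \<in> I}"
  unfolding One_nat_def
proof (rule Ck_on_SucI[OF open_strip[OF I(1)] chart_deriv])
  fix v :: "'a \<times> real"
  show "Ck_on 0 (\<lambda>z :: 'a \<times> real. ((fst v, exp (snd z) * snd v), tan (\<theta> (snd z)) * snd v)) {z. snd z \<in> I}"
    using I by (auto intro!: continuous_intros continuous_on_comp_snd[of I "\<lambda>s. tan (\<theta> s)"]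
        tan_angle_cont mem_sym_interval[of I L])
qed (use I mem_sym_interval[of I L] in auto)

lemma chart_C2:
  assumes I: "open I" "I \<subseteq> {-L<..<L} - {0}"
  shows "Ck_on 2 (chart :: 'a::euclidean_space \<times> real \<Rightarrow> _) {z. snd z \<in> I}"
  unfolding numeral_2_eq_2
proof (rule Ck_on_SucI[OF open_strip[OF I(1)] chart_deriv])
  fix v :: "'a \<times> real"
  define k where "k s = inverse ((cos (\<theta> s))\<^sup>2) * (1 / \<bar>sin (\<theta> s)\<bar> ^ m)" for s
  have I': "\<bar>s\<bar> < L" "s \<noteq> 0" if "s \<in> I" for s
    using I that mem_sym_interval[of I L] by auto
  have der: "((\<lambda>z. ((fst v, exp (snd z) * snd v), tan (\<theta> (snd z)) * snd v)) has_derivative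
      (\<lambda>w. ((0, exp (snd z) * snd w * snd v), k (snd z) * snd w * snd v))) (at z)"
    if "snd z \<in> I" for z :: "'a \<times> real"
    unfolding k_def
    by (intro has_derivative_Pair has_derivative_const has_derivative_mult_left
        has_derivative_comp_snd DERIV_exp tan_angle_deriv I' that)
  have k: "isCont k s" if "s \<in> I" for s
    unfolding k_def using I'[OF that] cos_angle_pos[of s] sin_angle_nonzero[of s] angle_cont[of s]
    by (intro continuous_intros) auto
  have "Ck_on 0 (\<lambda>z :: 'a \<times> real. ((0::'a, exp (snd z) * snd w * snd v), k (snd z) * snd w * snd v))
      {z. snd z \<in> I}" for w :: "'a \<times> real"
    by (auto intro!: continuous_intros continuous_on_comp_snd[of I k] k)
  with der show "Ck_on (Suc 0) (\<lambda>z :: 'a \<times> real. ((fst v, exp (snd z) * snd v), tan (\<theta> (snd z)) * snd v)) {z. snd z \<in> I}"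
    by (intro Ck_on_SucI[OF open_strip[OF I(1)], where
        D="\<lambda>z w. ((0, exp (snd z) * snd w * snd v), k (snd z) * snd w * snd v)"]) auto
qed (use I mem_sym_interval[of I L] in auto)

text \<open>
  The interval \<open>I\<close> localizes the parametrization, and the model space \<open>K\<close> cuts out the part of the
  slab over which the surface is present.
\<close>

lemma chart_local_param:
  assumes I: "open I" "I \<subseteq> {-L<..<L}" and J: "J \<subseteq> {-L<..<L}"
    and K: "\<And>z :: 'a::euclidean_space \<times> real. snd z \<in> I \<Longrightarrow> z \<in> K \<longleftrightarrow> snd z \<in> J"
    and k: "Ck_on k (chart :: 'a \<times> real \<Rightarrow> _) {z. snd z \<in> I}"
  shows "local_param k (surf J) K {z. snd z \<in> I} chart
           {p. 0 < snd (fst p) \<and> ln (snd (fst p)) \<in> I}"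
proof -
  have "inj (frechet_derivative chart (at z))" if "snd z \<in> I" for z :: "'a \<times> real"
  proof -
    have "\<bar>snd z\<bar> < L" using that I mem_sym_interval by blast
    from frechet_derivative_eqI[OF chart_deriv[OF this]] show ?thesis
      by (auto intro!: injI simp: prod_eq_iff)
  qed
  moreover have "homeomorphism ({z. snd z \<in> I} \<inter> K)
      (surf J \<inter> {p. 0 < snd (fst p) \<and> ln (snd (fst p)) \<in> I}) chart
      (\<lambda>p. (fst (fst p), ln (snd (fst p))))"
  proof
    have "continuous_on {z. snd z \<in> I} (\<lambda>z :: 'a \<times> real. \<phi> (snd z))"
      using I by (intro continuous_on_comp_snd profile_cont) (rule mem_sym_interval)
    then have "continuous_on {z. snd z \<in> I} (chart :: 'a \<times> real \<Rightarrow> _)"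
      unfolding chart_def by (intro continuous_intros)
    then show "continuous_on ({z. snd z \<in> I} \<inter> K) (chart :: 'a \<times> real \<Rightarrow> _)"
      by (rule continuous_on_subset) auto
    show "continuous_on (surf J \<inter> {p. 0 < snd (fst p) \<and> ln (snd (fst p)) \<in> I})
        (\<lambda>p :: 'a hyp_line. (fst (fst p), ln (snd (fst p))))"
      by (intro continuous_intros) auto
  qed (use K in \<open>auto simp: surf_def chart_def prod_eq_iff\<close>)
  ultimately show ?thesis
    using open_strip[OF I(1)] open_tube[OF I(1)] k by (auto simp: local_param_def)
qed

text \<open>
  The levels occupied by the two kinds of grim reapers: for \<open>n\<close> odd and for \<open>n\<close> even.
\<close>

definition reaper_levels :: "real set \<Rightarrow> bool" where
  "reaper_levels J \<longleftrightarrow> J = {-L<..<L} \<or> J = {0..<L}"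

lemma reaper_levels_subset: "reaper_levels J \<Longrightarrow> J \<subseteq> {-L<..<L}"
  using L_pos by (auto simp: reaper_levels_def)

lemma reaper_levels_abs: "reaper_levels J \<Longrightarrow> s \<in> J \<Longrightarrow> \<bar>s\<bar> < L"
  using reaper_levels_subset mem_sym_interval by blast

lemma reaper_levels_model_space:
  assumes "reaper_levels J"
  obtains K :: "('a::euclidean_space \<times> real) set"
  where "K \<in> model_spaces" "\<And>z. \<bar>snd z\<bar> < L \<Longrightarrow> z \<in> K \<longleftrightarrow> snd z \<in> J"
proof (cases "J = {0..<L}")
  case True
  then show ?thesis by (intro that[of "{z. 0 \<le> snd z}"]) (auto simp: model_spaces_def)
next
  case False
  then have "J = {-L<..<L}" using assms by (simp add: reaper_levels_def)
  then show ?thesis by (intro that[of UNIV]) (auto simp: model_spaces_def)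
qed

lemma surf_regular_C2:
  fixes p :: "'a::euclidean_space hyp_line"
  assumes "reaper_levels J" "p \<in> surf J" "ln (snd (fst p)) \<noteq> 0"
  shows "regular_at 2 (surf J) p"
proof -
  obtain K :: "('a \<times> real) set"
    where K: "K \<in> model_spaces" "\<And>z. \<bar>snd z\<bar> < L \<Longrightarrow> z \<in> K \<longleftrightarrow> snd z \<in> J"
    using reaper_levels_model_space[OF assms(1)] by blast
  let ?I = "{-L<..<L} - {0}"
  have "local_param 2 (surf J) K {z. snd z \<in> ?I} chart {p. 0 < snd (fst p) \<and> ln (snd (fst p)) \<in> ?I}"
    using reaper_levels_subset[OF assms(1)]
    by (intro chart_local_param chart_C2 K(2)) auto
  moreover have "p \<in> surf J \<inter> {p. 0 < snd (fst p) \<and> ln (snd (fst p)) \<in> ?I}"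
    using assms reaper_levels_subset[OF assms(1)] by (auto simp: surf_def)
  ultimately show ?thesis using K(1) unfolding regular_at_def by blast
qed

lemma surf_local_param_C1:
  assumes "reaper_levels J"
  obtains K :: "('a::euclidean_space \<times> real) set" where "K \<in> model_spaces"
    "local_param 1 (surf J) K {z. snd z \<in> {-L<..<L}} chart
       {p. 0 < snd (fst p) \<and> ln (snd (fst p)) \<in> {-L<..<L}}"
proof -
  obtain K :: "('a \<times> real) set"
    where K: "K \<in> model_spaces" "\<And>z. \<bar>snd z\<bar> < L \<Longrightarrow> z \<in> K \<longleftrightarrow> snd z \<in> J"
    using reaper_levels_model_space[OF assms(1)] by blast
  show ?thesis
    using reaper_levels_subset[OF assms(1)]
    by (intro that[OF K(1)] chart_local_param chart_C1 K(2)) auto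
qed

lemma surf_tube: "reaper_levels J \<Longrightarrow> p \<in> surf J \<Longrightarrow>
    p \<in> {p. 0 < snd (fst p) \<and> ln (snd (fst p)) \<in> {-L<..<L}}"
  using reaper_levels_subset[of J] by (auto simp: surf_def)

end

section \<open>The singular set\<close>

context reaper_profile
begin

text \<open>
  In any parametrization, not only in \<open>chart\<close>, velocities obey the slope relation of the profile.
\<close>

lemma surf_param_slope:
  fixes f :: "'a::euclidean_space \<times> real \<Rightarrow> 'a hyp_line"
  assumes J: "J \<subseteq> {-L<..<L}" and e: "0 \<le> t" "t < e"
    and ray: "\<And>t. 0 \<le> t \<Longrightarrow> t < e \<Longrightarrow> z + t *\<^sub>R v \<in> U \<inter> K"
    and f: "f ` (U \<inter> K) \<subseteq> surf J" "\<And>z. z \<in> U \<Longrightarrow> f differentiable (at z)"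
  defines "zt \<equiv> z + t *\<^sub>R v"
  shows "snd (frechet_derivative f (at zt) v) = tan (\<theta> (ln (snd (fst (f zt))))) *
           (snd (fst (frechet_derivative f (at zt) v)) / snd (fst (f zt)))"
  unfolding zt_def
proof (rule surf_velocity[OF J, of t "{0..<e}" "\<lambda>t. f (z + t *\<^sub>R v)"])
  show "at t within {0..<e} \<noteq> bot" using e by (rule at_within_Ico_nontrivial)
  show "(\<lambda>t. f (z + t *\<^sub>R v)) ` {0..<e} \<subseteq> surf J" using f(1) ray by auto
  show "((\<lambda>t. f (z + t *\<^sub>R v)) has_vector_derivative
      frechet_derivative f (at (z + t *\<^sub>R v)) v) (at t within {0..<e})"
    using e ray f(2) by (intro straight_path_velocity) blast
qed (use e in auto)

text \<open>
  Suppose \<open>f\<close> is a \<open>C\<^sup>2\<close> parametrization near a point at level 0. As the surface is horizontal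
  there and the derivative of \<open>f\<close> is injective, some inward direction \<open>v\<close> changes the level \<open>\<sigma>\<close>
  at a rate \<open>d \<noteq> 0\<close>. Along the ray in this direction the height has derivative
  \<open>A = tan (\<theta> \<sigma>) \<sigma>'\<close>. This is differentiable at 0 and vanishes there, so \<open>A t / t\<close> converges.
  But \<open>A t / t = (tan (\<theta> \<sigma>) / \<sigma>) (\<sigma> / t) \<sigma>'\<close>, where the last two factors tend to \<open>d\<close> and the
  first one to infinity.
\<close>

lemma not_C2_at_level_zero:
  fixes p :: "'a::euclidean_space hyp_line"
  assumes J: "J \<subseteq> {-L<..<L}" and p: "p \<in> surf J" "ln (snd (fst p)) = 0"
  shows "\<not> regular_at 2 (surf J) p"
proof
  assume "regular_at 2 (surf J) p"
  then obtain K U f W where K: "K \<in> model_spaces" and lp: "local_param 2 (surf J) K U f W"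
    and pW: "p \<in> surf J \<inter> W" unfolding regular_at_def by blast
  from lp obtain g where U: "open U" and C2: "Ck_on 2 f U"
    and inj: "\<And>z. z \<in> U \<Longrightarrow> inj (frechet_derivative f (at z))"
    and hom: "homeomorphism (U \<inter> K) (surf J \<inter> W) f g"
    unfolding local_param_def by blast
  let ?D = "\<lambda>z. frechet_derivative f (at z)"
  have diff: "f differentiable (at z)" if "z \<in> U" for z using C2 that by (simp add: numeral_2_eq_2)
  have diff2: "(\<lambda>z. ?D z v) differentiable (at z)" if "z \<in> U" for z v
    using C2[unfolded numeral_2_eq_2 Ck_on.simps] that by blast
  have f_surf: "f ` (U \<inter> K) \<subseteq> surf J" using homeomorphism_image1[OF hom] by auto
  define z where "z = g p"
  have z: "z \<in> U \<inter> K" "f z = p"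
    using homeomorphism_image2[OF hom] homeomorphism_apply2[OF hom pW] pW by (auto simp: z_def)
  have y1: "snd (fst p) = 1" using p by (auto simp: surf_def)
  have lin: "linear (?D z)"
    using diff z frechet_derivative_works has_derivative_linear by blast
  have horizontal: "snd (?D z v) = 0" if v: "0 \<le> snd v" for v
  proof -
    obtain e where e: "0 < e" "\<And>t. 0 \<le> t \<Longrightarrow> t < e \<Longrightarrow> z + t *\<^sub>R v \<in> U \<inter> K"
      using ray_in_model_space[OF K U z(1) v] by blast
    from surf_param_slope[OF J _ e(1) e(2) f_surf diff] show ?thesis
      by (simp add: z(2) p(2))
  qed
  obtain v where v: "0 \<le> snd v" "snd (fst (?D z v)) \<noteq> 0"
  proof -
    obtain v where v: "snd (fst (?D z v)) \<noteq> 0 \<or> snd (?D z v) \<noteq> 0"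
      using no_injective_linear_into_horizontal[OF lin inj] z by auto
    have neg: "?D z (- v) = - ?D z v" using lin by (rule linear_neg)
    show ?thesis
    proof (cases "0 \<le> snd v")
      case True
      then show ?thesis using v horizontal that by blast
    next
      case False
      then have "snd (?D z (- v)) = 0" by (intro horizontal) auto
      then show ?thesis using v False that[of "- v"] by (auto simp: neg)
    qed
  qed
  obtain e where e: "0 < e" "\<And>t. 0 \<le> t \<Longrightarrow> t < e \<Longrightarrow> z + t *\<^sub>R v \<in> U \<inter> K"
    using ray_in_model_space[OF K U z(1) v(1)] by blast
  define d where "d = snd (fst (?D z v))"
  define \<sigma> where "\<sigma> t = ln (snd (fst (f (z + t *\<^sub>R v))))" for t
  define A where "A t = snd (?D (z + t *\<^sub>R v) v)" for t
  define B where "B t = snd (fst (?D (z + t *\<^sub>R v) v)) / snd (fst (f (z + t *\<^sub>R v)))" for t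
  have slope: "A t = tan (\<theta> (\<sigma> t)) * B t" if "0 \<le> t" "t < e" for t
    unfolding A_def B_def \<sigma>_def
    using that e(2) by (intro surf_param_slope[OF J _ _ _ f_surf diff]) auto
  have \<sigma>_abs: "\<bar>\<sigma> t\<bar> < L" if "0 \<le> t" "t < e" for t
    using f_surf e(2)[OF that] J mem_sym_interval[OF J] unfolding \<sigma>_def surf_def by blast
  have \<sigma>0: "\<sigma> 0 = 0" by (simp add: \<sigma>_def z p)
  have A0: "A 0 = 0" using slope[of 0] e \<sigma>0 by simp
  have vd: "((\<lambda>t. f (z + t *\<^sub>R v)) has_vector_derivative ?D z v) (at 0)"
    using straight_path_velocity[of f z 0 v UNIV] diff z by simp
  have "((\<lambda>t. snd (fst (f (z + t *\<^sub>R v)))) has_real_derivative d) (at 0)"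
    unfolding has_real_derivative_iff_has_vector_derivative d_def
    by (intro bounded_linear.has_vector_derivative[OF bounded_linear_snd]
        bounded_linear.has_vector_derivative[OF bounded_linear_fst] vd)
  then have \<sigma>_deriv: "(\<sigma> has_real_derivative d) (at 0)"
    unfolding \<sigma>_def by (auto intro!: derivative_eq_intros simp: z y1)
  have vd2: "((\<lambda>t. ?D (z + t *\<^sub>R v) v) has_vector_derivative
      frechet_derivative (\<lambda>z. ?D z v) (at z) v) (at 0)"
    using straight_path_velocity[of "\<lambda>z. ?D z v" z 0 v UNIV] diff2 z by simp
  then obtain \<alpha> where A_deriv: "(A has_real_derivative \<alpha>) (at 0)"
    unfolding has_real_derivative_iff_has_vector_derivative A_def
    using bounded_linear.has_vector_derivative[OF bounded_linear_snd] by blast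
  have "isCont (\<lambda>t. ?D (z + t *\<^sub>R v) v) 0"
    using has_vector_derivative_continuous[OF vd2] .
  moreover have "isCont (\<lambda>t. f (z + t *\<^sub>R v)) 0"
    using has_vector_derivative_continuous[OF vd] .
  ultimately have "isCont B 0"
    unfolding B_def by (intro continuous_intros) (auto simp: z y1)
  then have B_lim: "(B \<longlongrightarrow> d) (at_right 0)"
    using z y1 by (auto simp: isCont_def B_def d_def intro: tendsto_within_subset)
  have A_lim: "((\<lambda>t. A t / t) \<longlongrightarrow> \<alpha>) (at_right 0)"
    using A_deriv A0 by (auto simp: has_field_derivative_iff intro: tendsto_within_subset)
  have \<sigma>_lim: "((\<lambda>t. \<sigma> t / t) \<longlongrightarrow> d) (at_right 0)"
    using \<sigma>_deriv \<sigma>0 by (auto simp: has_field_derivative_iff intro: tendsto_within_subset)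
  have "(\<sigma> \<longlongrightarrow> 0) (at_right 0)"
    using DERIV_isCont[OF \<sigma>_deriv] \<sigma>0 by (auto simp: isCont_def intro: tendsto_within_subset)
  then have R_lim: "((\<lambda>t. \<sigma> t / tan (\<theta> (\<sigma> t))) \<longlongrightarrow> 0) (at_right 0)"
    using isCont_tendsto_compose[OF inverse_slope_ratio_cont, of \<sigma>] by simp
  (* The relation for A / t, multiplied by the reciprocal of the diverging factor. *)
  have "\<forall>\<^sub>F t in at_right 0. 0 < t \<and> t < e"
    using e(1) by (auto simp: eventually_at_right_field)
  then have "\<forall>\<^sub>F t in at_right 0. \<sigma> t / tan (\<theta> (\<sigma> t)) * (A t / t) = \<sigma> t / t * B t"
  proof eventually_elim
    case (elim t)
    then have t: "0 < t" "t < e" by auto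
    have "\<sigma> t = 0" if "tan (\<theta> (\<sigma> t)) = 0"
      using angle_steep[OF \<sigma>_abs[of t]] t that by simp
    then show ?case using slope[of t] t by (cases "tan (\<theta> (\<sigma> t)) = 0") auto
  qed
  moreover have "((\<lambda>t. \<sigma> t / tan (\<theta> (\<sigma> t)) * (A t / t)) \<longlongrightarrow> 0 * \<alpha>) (at_right 0)"
    by (intro tendsto_mult R_lim A_lim)
  ultimately have lim0: "((\<lambda>t. \<sigma> t / t * B t) \<longlongrightarrow> 0 * \<alpha>) (at_right 0)"
    by (rule Lim_transform_eventually[rotated])
  have "((\<lambda>t. \<sigma> t / t * B t) \<longlongrightarrow> d * d) (at_right 0)"
    by (intro tendsto_mult \<sigma>_lim B_lim)
  then have "d * d = 0 * \<alpha>"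
    by (rule tendsto_unique[OF trivial_limit_at_right_real _ lim0])
  then show False using v by (simp add: d_def)
qed

lemma C2_singular_set_level_zero:
  assumes "reaper_levels J"
  shows "C2_singular_set (surf J :: 'a::euclidean_space hyp_line set) =
           {p \<in> surf J. ln (snd (fst p)) = 0}"
  using surf_regular_C2[OF assms] not_C2_at_level_zero[OF reaper_levels_subset[OF assms]]
  unfolding C2_singular_set_def by blast

lemma surf_hypersurface:
  assumes "reaper_levels J"
  shows "hypersurface (surf J :: 'a::euclidean_space hyp_line set)"
  unfolding hypersurface_def
proof (intro conjI ballI)
  have "0 \<in> J" using assms L_pos by (auto simp: reaper_levels_def)
  then have "((0, 1), \<phi> 0) \<in> surf J" by (simp add: surf_def)
  then show "surf J \<noteq> ({} :: 'a hyp_line set)" by blast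
  show "surf J \<subseteq> (hyp \<times> UNIV :: 'a hyp_line set)" by (auto simp: surf_def hyp_def)
  obtain K :: "('a \<times> real) set" where K: "K \<in> model_spaces"
    and lp: "local_param 1 (surf J) K {z. snd z \<in> {-L<..<L}} chart
       {p. 0 < snd (fst p) \<and> ln (snd (fst p)) \<in> {-L<..<L}}"
    using surf_local_param_C1[OF assms] by blast
  show "regular_at 1 (surf J) p" if "p \<in> surf J" for p :: "'a hyp_line"
    unfolding regular_at_def using K lp surf_tube[OF assms that] that by blast
  have "negligible {z \<in> {z. snd z \<in> {-L<..<L}} \<inter> K. chart z \<in> C2_singular_set (surf J)}"
    by (rule negligible_subset[OF negligible_horizontal[of 0]])
       (auto simp: C2_singular_set_level_zero[OF assms] chart_def)
  then show "null_in (surf J) (C2_singular_set (surf J :: 'a hyp_line set))"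
    unfolding null_in_def using K lp surf_tube[OF assms] by blast
qed

end

section \<open>Tangent spaces and curvature\<close>

context reaper_profile
begin

definition tangent_plane :: "'a::euclidean_space hyp_line \<Rightarrow> 'a hyp_line set" where
  "tangent_plane p = {v. snd v = tan (\<theta> (ln (snd (fst p)))) * (snd (fst v) / snd (fst p))}"

lemma subspace_tangent_plane: "subspace (tangent_plane p)"
  by (auto simp: subspace_def tangent_plane_def algebra_simps add_divide_distrib)

text \<open>
  Moving towards higher levels stays in the surface for a short time, even from a boundary point.
\<close>

lemma surf_curve:
  fixes p v :: "'a::euclidean_space hyp_line"
  assumes J: "reaper_levels J" and p: "p \<in> surf J"
    and v: "v \<in> tangent_plane p" "0 \<le> snd (fst v)"
  obtains c e where "0 < e" "c 0 = p" "c ` {0..<e} \<subseteq> surf J"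
    "(c has_vector_derivative v) (at (0::real) within {0..<e})"
proof -
  define y where "y = snd (fst p)"
  define \<eta> where "\<eta> = snd (fst v)"
  have y: "0 < y" "ln y \<in> J" "snd p = \<phi> (ln y)" using p by (auto simp: surf_def y_def)
  have yL: "\<bar>ln y\<bar> < L" using reaper_levels_abs[OF J y(2)] .
  then have "y < exp L" using y(1) by (metis abs_ge_self exp_less_cancel_iff exp_ln le_less_trans)
  have \<eta>: "0 \<le> \<eta>" using v by (simp add: \<eta>_def)
  (* Chosen such that the last coordinate stays below exp L, the end of the slab. *)
  define e where "e = (exp L - y) / (\<eta> + 1)"
  have e: "0 < e" using \<open>y < exp L\<close> \<eta> by (simp add: e_def)
  define c where "c t = (fst p + t *\<^sub>R fst v, \<phi> (ln (y + t * \<eta>)))" for t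
  have "c t \<in> surf J" if "0 \<le> t" "t < e" for t
  proof -
    have "t * \<eta> \<le> t * (\<eta> + 1)" using that by (simp add: mult_left_mono)
    also have "\<dots> < exp L - y" using that \<eta> by (simp add: e_def pos_less_divide_eq)
    finally have "y + t * \<eta> < exp L" by simp
    moreover have ge: "y \<le> y + t * \<eta>" using that \<eta> by simp
    ultimately have "ln (y + t * \<eta>) < L" "ln y \<le> ln (y + t * \<eta>)"
      using y(1) ln_less_cancel_iff[of "y + t * \<eta>" "exp L"] ln_le_cancel_iff[of y "y + t * \<eta>"]
      by simp_all
    then have "ln (y + t * \<eta>) \<in> J" using y(2) J by (auto simp: reaper_levels_def)
    then show ?thesis using ge y(1) by (simp add: c_def surf_def y_def \<eta>_def)
  qed
  then have "c ` {0..<e} \<subseteq> surf J" by auto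
  moreover have "(c has_vector_derivative v) (at 0 within {0..<e})"
  proof -
    have "((\<lambda>t. \<phi> (ln (y + t * \<eta>))) has_real_derivative tan (\<theta> (ln (y + 0 * \<eta>))) * (1 / y * \<eta>)) (at 0 within {0..<e})"
      using yL y(1) by (intro DERIV_chain2[where f=\<phi>] profile_deriv) (auto intro!: derivative_eq_intros)
    also have "tan (\<theta> (ln (y + 0 * \<eta>))) * (1 / y * \<eta>) = snd v"
      using v by (simp add: tangent_plane_def y_def \<eta>_def)
    finally have "((\<lambda>t. \<phi> (ln (y + t * \<eta>))) has_vector_derivative snd v) (at 0 within {0..<e})"
      by (simp add: has_real_derivative_iff_has_vector_derivative)
    moreover have "((\<lambda>t. fst p + t *\<^sub>R fst v) has_vector_derivative fst v) (at 0 within {0..<e})"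
      by (auto intro!: derivative_eq_intros simp: has_vector_derivative_def)
    ultimately show ?thesis unfolding c_def
      using has_vector_derivative_Pair by fastforce
  qed
  moreover have "c 0 = p" using y by (simp add: c_def prod_eq_iff)
  ultimately show ?thesis using that e by blast
qed

text \<open>
  Vectors pointing to lower levels need not be velocities of curves in the surface, but their
  negatives are.
\<close>

lemma tangent_space_surf:
  fixes p :: "'a::euclidean_space hyp_line"
  assumes J: "reaper_levels J" and p: "p \<in> surf J"
  shows "tangent_space (surf J) p = tangent_plane p"
proof
  show "tangent_space (surf J) p \<subseteq> tangent_plane p"
    unfolding tangent_space_def
  proof (rule span_minimal[OF _ subspace_tangent_plane], clarify)
    fix v :: "'a hyp_line" and c e
    assume c: "0 < (e::real)" "c ` {0..<e} \<subseteq> surf J"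
      "(c has_vector_derivative v) (at 0 within {0..<e})" and "p = c 0"
    then show "v \<in> tangent_plane (c 0)"
      using surf_velocity[OF reaper_levels_subset[OF J], of 0 "{0..<e}" c v] at_within_Ico_nontrivial[of 0 e]
      by (simp add: tangent_plane_def)
  qed
  have pos: "v \<in> tangent_space (surf J) p" if "v \<in> tangent_plane p" "0 \<le> snd (fst v)" for v
    unfolding tangent_space_def using surf_curve[OF J p that] by (intro span_base) blast
  show "tangent_plane p \<subseteq> tangent_space (surf J) p"
  proof
    fix v assume v: "v \<in> tangent_plane p"
    show "v \<in> tangent_space (surf J) p"
    proof (cases "0 \<le> snd (fst v)")
      case False
      then have "- v \<in> tangent_space (surf J) p"
        using v by (intro pos) (auto intro: subspace_neg[OF subspace_tangent_plane])
      then have "- (- v) \<in> tangent_space (surf J) p"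
        unfolding tangent_space_def by (rule span_neg)
      then show ?thesis by simp
    qed (use v pos in auto)
  qed
qed

text \<open>
  A derivative within a hypersurface is not unique, but any two agree on velocities of curves in it.
  The covariant derivative of a field given in the ambient space can therefore be computed there.
\<close>

lemma frechet_derivative_within_surf:
  fixes p v :: "'a::euclidean_space hyp_line" and V :: "'a hyp_line \<Rightarrow> 'a hyp_line"
  assumes J: "reaper_levels J" and p: "p \<in> surf J" and v: "v \<in> tangent_plane p" "0 \<le> snd (fst v)"
    and V: "(V has_derivative V') (at p)"
  shows "frechet_derivative V (at p within surf J) v = V' v"
proof -
  obtain c e where c: "0 < e" "c 0 = p" "c ` {0..<e} \<subseteq> surf J"
    "(c has_vector_derivative v) (at (0::real) within {0..<e})"
    using surf_curve[OF J p v] by blast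
  have along: "((V \<circ> c) has_vector_derivative D v) (at 0 within {0..<e})"
    if "(V has_derivative D) (at p within surf J)" for D
    by (rule vector_derivative_diff_chain_within[OF c(4)])
       (use that c has_derivative_subset in blast)
  have V1: "(V has_derivative V') (at p within surf J)" using V by (rule has_derivative_at_withinI)
  then have "(V has_derivative frechet_derivative V (at p within surf J)) (at p within surf J)"
    using frechet_derivative_works differentiable_def by blast
  then show ?thesis
    using vector_derivative_unique_within[OF _ along along] V1 at_within_Ico_nontrivial[of 0 e] c(1) by blast
qed

text \<open>
  The upward unit normal multiplied by the sign \<open>\<epsilon>\<close>, extended to all of the slab as
  independent of the horospherical coordinates and of the height.
\<close>

definition normal_field :: "real \<Rightarrow> 'a::euclidean_space hyp_line \<Rightarrow> 'a hyp_line" where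
  "normal_field \<epsilon> p = ((0, - (\<epsilon> * snd (fst p) * sin (\<theta> (ln (snd (fst p)))))),
     \<epsilon> * cos (\<theta> (ln (snd (fst p)))))"

lemma unit_normal_surf:
  assumes J: "reaper_levels J" and \<epsilon>: "\<epsilon>\<^sup>2 = 1"
  shows "unit_normal (surf J :: 'a::euclidean_space hyp_line set) (normal_field \<epsilon>)"
  unfolding unit_normal_def
proof (intro conjI ballI)
  have "continuous_on (surf J) (\<lambda>p :: 'a hyp_line. \<theta> (ln (snd (fst p))))"
  proof (rule continuous_on_compose2[of J \<theta>])
    show "continuous_on J \<theta>"
      using reaper_levels_abs[OF J] angle_cont by (intro continuous_at_imp_continuous_on) auto
    show "continuous_on (surf J) (\<lambda>p :: 'a hyp_line. ln (snd (fst p)))"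
      by (intro continuous_intros) (auto simp: surf_def)
  qed (auto simp: surf_def)
  then show "continuous_on (surf J) (normal_field \<epsilon> :: 'a hyp_line \<Rightarrow> _)"
    unfolding normal_field_def by (intro continuous_intros)
next
  fix p :: "'a hyp_line" assume p: "p \<in> surf J"
  define y where "y = snd (fst p)"
  define t where "t = \<theta> (ln y)"
  have y: "0 < y" using p by (simp add: surf_def y_def)
  have "riem_metric p (normal_field \<epsilon> p) (normal_field \<epsilon> p) = \<epsilon>\<^sup>2 * (sin t)\<^sup>2 + \<epsilon>\<^sup>2 * (cos t)\<^sup>2"
    using y by (simp add: riem_metric_def normal_field_def y_def[symmetric] t_def[symmetric] inner_prod_def
        power2_eq_square algebra_simps)
  then show "riem_metric p (normal_field \<epsilon> p) (normal_field \<epsilon> p) = 1"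
    using \<epsilon> sin_cos_squared_add[of t] by simp
  fix v assume "v \<in> tangent_space (surf J) p"
  then have v: "snd v = tan t * (snd (fst v) / y)"
    using tangent_space_surf[OF J p] by (simp add: tangent_plane_def y_def t_def)
  have "cos t \<noteq> 0"
    using cos_angle_pos[of "ln y"] reaper_levels_abs[OF J, of "ln y"] p by (simp add: surf_def y_def t_def)
  then show "riem_metric p (normal_field \<epsilon> p) v = 0"
    using y by (simp add: riem_metric_def normal_field_def y_def[symmetric] t_def[symmetric] inner_prod_def v tan_def)
      (simp add: field_simps power2_eq_square)
qed

lemma normal_field_deriv:
  fixes p :: "'a::euclidean_space hyp_line"
  defines "y \<equiv> snd (fst p)"
  assumes y: "0 < y" "\<bar>ln y\<bar> < L" "ln y \<noteq> 0"
  defines "t \<equiv> \<theta> (ln y)"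
  defines "r \<equiv> 1 / \<bar>sin t\<bar> ^ m"
  shows "(normal_field \<epsilon> has_derivative
     (\<lambda>v. ((0, - (\<epsilon> * (sin t + cos t * r) * snd (fst v))), - (\<epsilon> * sin t * r / y * snd (fst v))))) (at p)"
proof -
  have \<theta>: "((\<lambda>y. \<theta> (ln y)) has_real_derivative r * (1 / y)) (at y)"
    unfolding r_def t_def using y
    by (intro DERIV_chain2[where f=\<theta>] angle_deriv) (auto intro!: derivative_eq_intros)
  have 1: "((\<lambda>y. - (\<epsilon> * y * sin (\<theta> (ln y)))) has_real_derivative - (\<epsilon> * (sin t + cos t * r))) (at (snd (fst p)))"
    unfolding y_def[symmetric]
    using y(1) by (auto intro!: derivative_eq_intros \<theta> simp: t_def field_simps)
  have 2: "((\<lambda>y. \<epsilon> * cos (\<theta> (ln y))) has_real_derivative - (\<epsilon> * sin t * r / y)) (at (snd (fst p)))"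
    unfolding y_def[symmetric]
    using y(1) by (auto intro!: derivative_eq_intros \<theta> simp: t_def field_simps)
  have *: "((\<lambda>p :: 'a hyp_line. g (snd (fst p))) has_derivative (\<lambda>v. d * snd (fst v))) (at p)"
    if "(g has_real_derivative d) (at (snd (fst p)))" for g d
    using has_derivative_compose[OF has_derivative_snd[OF has_derivative_fst[OF has_derivative_ident]],
        of g "(*) d" p UNIV] that by (simp add: has_field_derivative_def)
  show ?thesis
    unfolding normal_field_def using *[OF 1] *[OF 2]
    by (intro has_derivative_Pair has_derivative_const) simp_all
qed

text \<open>
  The principal directions are an orthonormal frame of the horosphere, with principal curvature
  \<open>- \<epsilon> sin \<theta>\<close>, and the unit tangent of the profile curve, with principal curvature
  \<open>\<epsilon> cos \<theta> / \<bar>sin \<theta>\<bar> ^ m\<close>. By \<open>sign\<close> their product is \<open>\<epsilon> cos \<theta>\<close>, the angle function.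
\<close>

lemma gauss_curvature_eq_angle:
  fixes p :: "'a::euclidean_space hyp_line"
  assumes dim: "DIM('a) = m" and J: "reaper_levels J" and p: "p \<in> surf J"
    and s: "ln (snd (fst p)) \<noteq> 0"
    and sign: "(- (\<epsilon> * sin (\<theta> (ln (snd (fst p)))))) ^ m = \<bar>sin (\<theta> (ln (snd (fst p))))\<bar> ^ m"
  shows "has_gauss_curvature (surf J) (normal_field \<epsilon>) p (angle_function (normal_field \<epsilon>) p)"
proof -
  define y where "y = snd (fst p)"
  define t where "t = \<theta> (ln y)"
  define r where "r = 1 / \<bar>sin t\<bar> ^ m"
  have y: "0 < y" "ln y \<in> J" using p by (auto simp: surf_def y_def)
  have yL: "\<bar>ln y\<bar> < L" using reaper_levels_abs[OF J y(2)] .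
  have ct: "0 < cos t" using cos_angle_pos[OF yL] by (simp add: t_def)
  have st: "sin t \<noteq> 0" using sin_angle_nonzero[OF yL] s by (simp add: t_def y_def)
  obtain b where b: "bij_betw b {..<m} (Basis :: 'a set)"
    using ex_bij_betw_nat_finite[of "Basis :: 'a set"] dim by (auto simp: atLeast0LessThan)
  (* The first vectors have Euclidean length y, hence Riemannian length 1. *)
  define e :: "nat \<Rightarrow> 'a hyp_line" where
    "e i = (if i < m then ((y *\<^sub>R b i, 0), 0) else ((0, y * cos t), sin t))" for i
  define k where "k i = (if i < m then - (\<epsilon> * sin t) else \<epsilon> * cos t * r)" for i
  have e_tan: "e i \<in> tangent_plane p" "0 \<le> snd (fst (e i))" for i
    using y(1) ct by (auto simp: e_def tangent_plane_def y_def[symmetric] t_def[symmetric] tan_def)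
  have b_orth: "b i \<bullet> b j = (if i = j then 1 else 0)" if "i < m" "j < m" for i j
  proof -
    have "b i \<in> Basis" "b j \<in> Basis" "b i = b j \<longleftrightarrow> i = j"
      using that b bij_betwE[OF b] by (auto simp: bij_betw_def inj_on_eq_iff)
    then show ?thesis by (simp add: inner_Basis)
  qed
  have orth: "riem_metric p (e i) (e j) = (if i = j then 1 else 0)" if "i \<le> m" "j \<le> m" for i j
    using that y(1) b_orth[of i j] sin_cos_squared_add[of t]
    by (auto simp: riem_metric_def e_def inner_prod_def y_def[symmetric] power2_eq_square)
  have span: "span (e ` {..m}) = tangent_plane p"
  proof
    show "span (e ` {..m}) \<subseteq> tangent_plane p"
      using e_tan by (intro span_minimal subspace_tangent_plane) auto
    show "tangent_plane p \<subseteq> span (e ` {..m})"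
    proof
      fix v assume "v \<in> tangent_plane p"
      then have v: "snd v = tan t * (snd (fst v) / y)"
        by (simp add: tangent_plane_def y_def t_def)
      have "v = (\<Sum>i<m. ((fst (fst v) \<bullet> b i) / y) *\<^sub>R e i) + (snd (fst v) / (y * cos t)) *\<^sub>R e m"
      proof -
        have "(\<Sum>i<m. ((fst (fst v) \<bullet> b i) / y) *\<^sub>R e i) = ((\<Sum>i<m. (fst (fst v) \<bullet> b i) *\<^sub>R b i, 0), 0)"
          using y(1) by (simp add: prod_eq_iff fst_sum snd_sum e_def)
        also have "(\<Sum>i<m. (fst (fst v) \<bullet> b i) *\<^sub>R b i) = fst (fst v)"
          using sum.reindex_bij_betw[OF b, of "\<lambda>b. (fst (fst v) \<bullet> b) *\<^sub>R b"] by (simp add: euclidean_representation)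
        finally show ?thesis
          using y(1) ct v by (simp add: prod_eq_iff e_def tan_def mult.commute)
      qed
      also have "\<dots> \<in> span (e ` {..m})"
        by (intro span_add span_sum span_scale span_base) auto
      finally show "v \<in> span (e ` {..m})" .
    qed
  qed
  have shape: "shape_operator (surf J) (normal_field \<epsilon>) p (e i) = k i *\<^sub>R e i" for i
  proof -
    have DN: "frechet_derivative (normal_field \<epsilon>) (at p within surf J) (e i) =
       ((0, - (\<epsilon> * (sin t + cos t * r) * snd (fst (e i)))), - (\<epsilon> * sin t * r / y * snd (fst (e i))))"
      unfolding t_def r_def y_def
      by (rule frechet_derivative_within_surf[OF J p e_tan], rule normal_field_deriv)
         (use y yL s in \<open>auto simp: y_def\<close>)
    have Ch: "christoffel p (e i) (normal_field \<epsilon> p) =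
       ((1 / y) *\<^sub>R ((0, fst (e i) \<bullet> fst (normal_field \<epsilon> p)) - snd (fst (e i)) *\<^sub>R fst (normal_field \<epsilon> p)
          - snd (fst (normal_field \<epsilon> p)) *\<^sub>R fst (e i)), 0)"
      unfolding y_def using y(1) by (intro christoffel_half_space) (simp add: y_def)
    show ?thesis
      unfolding shape_operator_def cov_deriv_def DN Ch using y(1)
      by (auto simp: e_def k_def normal_field_def inner_prod_def
          y_def[symmetric] t_def[symmetric] prod_eq_iff field_simps)
  qed
  have "principal_curvatures (surf J) (normal_field \<epsilon>) p k"
    unfolding principal_curvatures_def
    using orth span shape tangent_space_surf[OF J p] dim
    by (intro exI[of _ e]) (simp add: lessThan_Suc_atMost less_Suc_eq_le)
  moreover have "(\<Prod>i<DIM('a \<times> real). k i) = \<epsilon> * cos t"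
  proof -
    have "(\<Prod>i<DIM('a \<times> real). k i) = (\<Prod>i<m. k i) * k m" by (simp add: dim)
    also have "\<dots> = (- (\<epsilon> * sin t)) ^ m * (\<epsilon> * cos t * r)" by (simp add: k_def)
    also have "\<dots> = \<epsilon> * cos t" using sign st by (simp add: r_def t_def y_def)
    finally show ?thesis .
  qed
  moreover have "angle_function (normal_field \<epsilon>) p = \<epsilon> * cos t"
    by (simp add: angle_function_def riem_metric_def vertical_def normal_field_def t_def y_def)
  ultimately show ?thesis unfolding has_gauss_curvature_def by metis
qed

lemma n_translator_surf:
  assumes dim: "DIM('a::euclidean_space) = m" and J: "reaper_levels J" and \<epsilon>: "\<epsilon>\<^sup>2 = 1"
    and sign: "\<And>s. s \<in> J \<Longrightarrow> s \<noteq> 0 \<Longrightarrow> (- (\<epsilon> * sin (\<theta> s))) ^ m = \<bar>sin (\<theta> s)\<bar> ^ m"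
  shows "n_translator (surf J :: 'a hyp_line set)"
  unfolding n_translator_def C2_singular_set_level_zero[OF J]
proof (intro conjI exI[of _ "normal_field \<epsilon>"] ballI)
  fix p :: "'a hyp_line" assume "p \<in> surf J - {p \<in> surf J. ln (snd (fst p)) = 0}"
  then show "has_gauss_curvature (surf J) (normal_field \<epsilon>) p (angle_function (normal_field \<epsilon>) p)"
    by (intro gauss_curvature_eq_angle dim J sign) (auto simp: surf_def)
qed (use surf_hypersurface[OF J] unit_normal_surf[OF J \<epsilon>] in auto)

end

section \<open>Invariance, height, asymptotics and boundary\<close>

context reaper_profile
begin

lemma parabolic_surf: "parabolic None (surf J :: 'a::euclidean_space hyp_line set)"
  unfolding parabolic_def
proof
  fix v :: 'a
  let ?T = "\<lambda>(v :: 'a) (z, t :: real). (parabolic_translation None v z, t)"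
  have T: "?T v p = (fst p + (v, 0), snd p)" for v :: 'a and p :: "'a hyp_line"
    by (cases p) (simp add: parabolic_translation_def)
  have sub: "?T v p \<in> surf J" if "p \<in> surf J" for v p
    using that unfolding T by (simp add: surf_def)
  show "?T v ` surf J = surf J"
  proof
    show "surf J \<subseteq> ?T v ` surf J"
    proof
      fix p :: "'a hyp_line" assume p: "p \<in> surf J"
      have "p = ?T v (?T (- v) p)" unfolding T by (simp add: prod_eq_iff)
      then show "p \<in> ?T v ` surf J" using sub[OF p, of "- v"] by (rule image_eqI)
    qed
  qed (use sub in blast)
qed

lemma vertical_graph_surf:
  assumes "- L \<le> a" "a < b" "b \<le> L"
  shows "vertical_graph (horo_region None a b) (surf {a<..<b} :: 'a::euclidean_space hyp_line set)"
  unfolding vertical_graph_def horo_region_None[OF assms(2)]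
proof (intro exI conjI)
  let ?I = "{exp a<..<exp b}"
  let ?u = "\<lambda>z :: 'a \<times> real. \<phi> (ln (snd z))"
  have I: "0 < y" "ln y \<in> {a<..<b}" "\<bar>ln y\<bar> < L" if "y \<in> ?I" for y
  proof -
    show y: "0 < y" using that less_trans[OF exp_gt_zero, of a y] by simp
    then show "ln y \<in> {a<..<b}"
      using that ln_less_cancel_iff[of y "exp b"] ln_less_cancel_iff[of "exp a" y] by auto
    then show "\<bar>ln y\<bar> < L" using assms by auto
  qed
  show "Ck_on 1 ?u {z. snd z \<in> ?I}"
    unfolding One_nat_def
  proof (rule Ck_on_SucI[OF open_strip])
    fix z :: "'a \<times> real" assume "z \<in> {z. snd z \<in> ?I}"
    then show "(?u has_derivative (\<lambda>v. tan (\<theta> (ln (snd z))) * (1 / snd z) * snd v)) (at z)"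
      using I[of "snd z"]
      by (intro has_derivative_comp_snd DERIV_chain2[where f=\<phi>] profile_deriv)
         (auto intro!: derivative_eq_intros)
  next
    fix v :: "'a \<times> real"
    have "isCont (\<lambda>y. tan (\<theta> (ln y)) * (1 / y)) y" if "y \<in> ?I" for y
      using I[OF that] by (intro continuous_intros isCont_o2[of y ln "\<lambda>s. tan (\<theta> s)"] tan_angle_cont) auto
    then show "Ck_on 0 (\<lambda>z :: 'a \<times> real. tan (\<theta> (ln (snd z))) * (1 / snd z) * snd v) {z. snd z \<in> ?I}"
      unfolding Ck_on.simps
      by (intro continuous_on_mult_right continuous_on_comp_snd[of ?I "\<lambda>y. tan (\<theta> (ln y)) * (1 / y)"])
  qed simp
  have "0 < y \<and> ln y \<in> {a<..<b} \<longleftrightarrow> y \<in> ?I" for y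
    using I[of y] ln_less_cancel_iff[of y "exp b"] ln_less_cancel_iff[of "exp a" y] by auto
  then show "(surf {a<..<b} :: 'a hyp_line set) = (\<lambda>z. (z, ?u z)) ` {z. snd z \<in> ?I}"
    by (fastforce simp: surf_def image_iff)
qed

text \<open>
  The elements of \<open>E\<close> are the ends \<open>\<plusminus>L\<close> of the slab that are approached by the levels in \<open>J\<close>. The
  point of a given height near an end is found by the intermediate value theorem on the profile.
\<close>

lemma surf_asymptotic:
  assumes J: "reaper_levels J" and E: "\<And>e. e \<in> E \<Longrightarrow> \<bar>e\<bar> = L"
    and EJ: "\<And>e r. e \<in> E \<Longrightarrow> 0 < r \<Longrightarrow> r < L \<Longrightarrow> sgn e * r \<in> J"
    and JE: "\<And>s. s \<in> J \<Longrightarrow> s \<noteq> 0 \<Longrightarrow> sgn s * L \<in> E"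
  shows "vertically_asymptotic (surf J) {z :: 'a::euclidean_space \<times> real. 0 < snd z \<and> ln (snd z) \<in> E}"
    (is "vertically_asymptotic _ ?C")
  unfolding vertically_asymptotic_def
proof (intro conjI allI impI)
  fix \<epsilon> :: real assume \<epsilon>: "0 < \<epsilon>"
  (* The halves keep s0 positive and L - s0 strictly below \<epsilon>. *)
  define s0 where "s0 = max (L / 2) (L - \<epsilon> / 2)"
  have s0: "0 < s0" "s0 < L" "L - s0 < \<epsilon>" using \<epsilon> L_pos by (auto simp: s0_def)
  show "\<exists>h. \<forall>t>h. (\<forall>w\<in>?C. \<exists>z. (z, t) \<in> surf J \<and> hyp_dist z w < \<epsilon>) \<and>
                   (\<forall>z. (z, t) \<in> surf J \<longrightarrow> (\<exists>w\<in>?C. hyp_dist z w < \<epsilon>))"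
  proof (intro exI[of _ "\<phi> s0"] allI impI conjI ballI)
    fix t and w :: "'a \<times> real" assume t: "\<phi> s0 < t" and w: "w \<in> ?C"
    define e where "e = ln (snd w)"
    have e: "e \<in> E" "e = sgn e * L" "sgn e = 1 \<or> sgn e = -1"
      using w E[of e] L_pos by (auto simp: e_def sgn_mult_abs[symmetric] sgn_real_def split: if_splits)
    obtain s1 where s1: "0 < s1" "s1 < L" "t < \<phi> s1" using profile_unbounded by blast
    then have "s0 < s1" using t profile_less[of s0 s1] s0 by auto
    moreover have "continuous_on {s0..s1} \<phi>"
      using s0 s1 by (intro continuous_at_imp_continuous_on ballI profile_cont) auto
    ultimately obtain s where s: "s0 \<le> s" "s \<le> s1" "\<phi> s = t"
      using IVT'[of \<phi> s0 t s1] t s1 by auto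
    define z where "z = (fst w, exp (sgn e * s))"
    have "\<phi> (sgn e * s) = t" using e(3) s profile_even[of s] s0 s1 by auto
    then have "(z, t) \<in> surf J" using EJ[OF e(1), of s] s s0 s1 by (simp add: z_def surf_def)
    moreover have "hyp_dist z w = \<bar>sgn e * s - sgn e * L\<bar>"
      using hyp_dist_vertical[of z w] w e(2) by (simp add: z_def e_def)
    then have "hyp_dist z w < \<epsilon>" using e(3) s s0 s1 by auto
    ultimately show "\<exists>z. (z, t) \<in> surf J \<and> hyp_dist z w < \<epsilon>" by blast
  next
    fix t and z :: "'a \<times> real" assume t: "\<phi> s0 < t" and z: "(z, t) \<in> surf J"
    define s where "s = ln (snd z)"
    have s: "0 < snd z" "s \<in> J" "\<phi> s = t" using z by (auto simp: surf_def s_def)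
    have sL: "\<bar>s\<bar> < L" using reaper_levels_abs[OF J s(2)] .
    then have "s0 < \<bar>s\<bar>" using profile_less[of s0 s] t s s0 by auto
    define w where "w = (fst z, exp (sgn s * L))"
    have "w \<in> ?C" using JE[OF s(2)] \<open>s0 < \<bar>s\<bar>\<close> s0 by (auto simp: w_def)
    moreover have "hyp_dist z w = \<bar>ln (snd z) - ln (snd w)\<bar>"
      by (rule hyp_dist_vertical) (use s(1) in \<open>simp_all add: w_def\<close>)
    then have "hyp_dist z w = \<bar>s - sgn s * L\<bar>" by (simp only: w_def s_def snd_conv ln_exp)
    then have "hyp_dist z w < \<epsilon>" using \<open>s0 < \<bar>s\<bar>\<close> s0 sL by (auto simp: sgn_real_def split: if_splits)
    ultimately show "\<exists>w\<in>?C. hyp_dist z w < \<epsilon>" by blast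
  qed
next
  fix h
  obtain s1 where s1: "0 < s1" "s1 < L" "h < \<phi> s1" using profile_unbounded by blast
  have "h < t" if "(z, t) \<in> surf J" "w \<in> ?C" "hyp_dist z w < L - s1" for z w :: "'a \<times> real" and t
  proof -
    have s: "0 < snd z" "ln (snd z) \<in> J" "\<phi> (ln (snd z)) = t" using that by (auto simp: surf_def)
    have "\<bar>ln (snd z) - ln (snd w)\<bar> < L - s1"
      using hyp_dist_ge_level_gap[of z w] that s by auto
    then have "s1 < \<bar>ln (snd z)\<bar>" using E[of "ln (snd w)"] that by auto
    then have "\<phi> s1 < t" using profile_less[of s1 "ln (snd z)"] s s1 reaper_levels_abs[OF J s(2)] by auto
    then show ?thesis using s1 by simp
  qed
  then show "\<exists>\<delta>>0. \<forall>(z, t)\<in>surf J. (\<exists>w\<in>?C. hyp_dist z w < \<delta>) \<longrightarrow> h < t"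
    using s1 by (intro exI[of _ "L - s1"]) auto
qed

lemma lowest_points_surf:
  assumes "reaper_levels J"
  shows "lowest_points (surf J :: 'a::euclidean_space hyp_line set) = horosphere None 0 \<times> {0}"
proof -
  have J0: "0 \<in> J" using assms L_pos by (auto simp: reaper_levels_def)
  have o: "((0, 1), 0) \<in> (surf J :: 'a hyp_line set)" using J0 by (simp add: surf_def profile_zero)
  have ge: "0 \<le> snd p \<and> (snd p = 0 \<longleftrightarrow> ln (snd (fst p)) = 0)" if "p \<in> surf J" for p :: "'a hyp_line"
    using that reaper_levels_abs[OF assms, of "ln (snd (fst p))"] profile_pos[of "ln (snd (fst p))"] profile_zero
    by (cases "ln (snd (fst p)) = 0") (auto simp: surf_def)
  have "p \<in> lowest_points (surf J) \<longleftrightarrow> p \<in> {p \<in> surf J. snd p = 0}" for p :: "'a hyp_line"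
  proof
    assume p: "p \<in> lowest_points (surf J)"
    then have "p \<in> surf J" "height p \<le> height ((0 :: 'a, 1 :: real), 0 :: real)"
      using o unfolding lowest_points_def by blast+
    then show "p \<in> {p \<in> surf J. snd p = 0}" using ge[of p] by (simp add: height_def)
  next
    assume p: "p \<in> {p \<in> surf J. snd p = 0}"
    have "height p \<le> height q" if "q \<in> surf J" for q :: "'a hyp_line"
      using ge[OF that] p by (simp add: height_def)
    with p show "p \<in> lowest_points (surf J)" by (simp add: lowest_points_def)
  qed
  then have "lowest_points (surf J) = {p \<in> surf J :: 'a hyp_line set. snd p = 0}" by blast
  also have "\<dots> = {p \<in> surf J. ln (snd (fst p)) = 0}" using ge by blast
  also have "\<dots> = horosphere None 0 \<times> {0}"
    using J0 profile_zero by (auto simp: surf_def horosphere_None)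
  finally show ?thesis .
qed

lemma C2_singular_set_horosphere:
  assumes "reaper_levels J"
  shows "C2_singular_set (surf J :: 'a::euclidean_space hyp_line set) = horosphere None 0 \<times> {0}"
proof -
  have "0 \<in> J" using assms L_pos by (auto simp: reaper_levels_def)
  then show ?thesis
    using profile_zero unfolding C2_singular_set_level_zero[OF assms]
    by (auto simp: surf_def horosphere_None)
qed

lemma height_surf:
  assumes J: "reaper_levels J"
  shows "bdd_below (height ` (surf J :: 'a::euclidean_space hyp_line set))"
    and "\<not> bdd_above (height ` (surf J :: 'a::euclidean_space hyp_line set))"
proof -
  have "((0, 1), 0) \<in> (horosphere None 0 \<times> {0} :: 'a hyp_line set)" by (simp add: horosphere_None)
  then show "bdd_below (height ` (surf J :: 'a hyp_line set))"
    unfolding lowest_points_surf[OF J, symmetric] by (auto simp: lowest_points_def bdd_below_def)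
  show "\<not> bdd_above (height ` (surf J :: 'a hyp_line set))"
  proof
    assume "bdd_above (height ` (surf J :: 'a hyp_line set))"
    then obtain M where M: "\<And>p. p \<in> (surf J :: 'a hyp_line set) \<Longrightarrow> height p \<le> M"
      by (auto simp: bdd_above_def)
    obtain s where s: "0 < s" "s < L" "M < \<phi> s" using profile_unbounded by blast
    have "((0, exp s), \<phi> s) \<in> (surf J :: 'a hyp_line set)"
      using s J by (auto simp: surf_def reaper_levels_def)
    from M[OF this] show False using s by (simp add: height_def)
  qed
qed

lemma interior_point_not_boundary:
  fixes p :: "'a::euclidean_space hyp_line"
  assumes J: "reaper_levels J" and I: "open I" "I \<subseteq> J" and p: "p \<in> surf J" "ln (snd (fst p)) \<in> I"
  shows "p \<notin> hs_boundary (surf J)"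
proof -
  have "I \<subseteq> {-L<..<L}" using I reaper_levels_subset[OF J] by blast
  then have "local_param 1 (surf J) (UNIV :: ('a \<times> real) set) {z. snd z \<in> I} chart
      {p. 0 < snd (fst p) \<and> ln (snd (fst p)) \<in> I}"
    using I reaper_levels_subset[OF J] by (intro chart_local_param chart_C1) auto
  moreover have "p \<in> {p. 0 < snd (fst p) \<and> ln (snd (fst p)) \<in> I}"
    using p by (auto simp: surf_def)
  ultimately show ?thesis unfolding hs_boundary_def by blast
qed

text \<open>
  In a parametrization by an open set, both the level and the height would have an interior minimum
  at such a point. The derivative would then take values in the horizontal subspace, which is too
  small for it to be injective.
\<close>

lemma minimal_point_is_boundary:
  fixes p :: "'a::euclidean_space hyp_line"
  assumes p: "p \<in> surf {0..<L}" "ln (snd (fst p)) = 0"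
  shows "p \<in> hs_boundary (surf {0..<L})"
proof (rule ccontr)
  assume "p \<notin> hs_boundary (surf {0..<L})"
  then obtain U f W where lp: "local_param 1 (surf {0..<L}) UNIV U f W" and pW: "p \<in> W"
    using p by (auto simp: hs_boundary_def)
  from lp obtain g where U: "open U" and C1: "Ck_on 1 f U"
    and inj: "\<And>z. z \<in> U \<Longrightarrow> inj (frechet_derivative f (at z))"
    and hom: "homeomorphism U (surf {0..<L} \<inter> W) f g"
    unfolding local_param_def by auto
  define z where "z = g p"
  have z: "z \<in> U" "f z = p"
    using homeomorphism_image2[OF hom] homeomorphism_apply2[OF hom] p(1) pW by (auto simp: z_def)
  have f_surf: "f w \<in> surf {0..<L}" if "w \<in> U" for w
    using homeomorphism_image1[OF hom] that by auto
  have "f differentiable (at z)" using C1 z(1) by simp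
  then have D: "(f has_derivative frechet_derivative f (at z)) (at z)"
    using frechet_derivative_works by blast
  have p1: "snd (fst p) = 1" "snd p = 0" using p profile_zero by (auto simp: surf_def)
  have min: "1 \<le> snd (fst (f w))" "0 \<le> snd (f w)" if "w \<in> U" for w
  proof -
    have *: "0 < snd (fst (f w))" "0 \<le> ln (snd (fst (f w)))" "ln (snd (fst (f w))) < L"
      "snd (f w) = \<phi> (ln (snd (fst (f w))))"
      using f_surf[OF that] by (auto simp: surf_def)
    then show "1 \<le> snd (fst (f w))" by simp
    show "0 \<le> snd (f w)"
      using * profile_pos[of "ln (snd (fst (f w)))"] profile_zero by (cases "ln (snd (fst (f w))) = 0") auto
  qed
  have "(\<lambda>v. snd (fst (frechet_derivative f (at z) v))) = (\<lambda>v. 0)"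
    by (rule differential_zero_maxmin[OF z(1) U, of "\<lambda>w. snd (fst (f w))"])
       (use min z p1 in \<open>auto intro!: has_derivative_snd has_derivative_fst D\<close>)
  moreover have "(\<lambda>v. snd (frechet_derivative f (at z) v)) = (\<lambda>v. 0)"
    by (rule differential_zero_maxmin[OF z(1) U, of "\<lambda>w. snd (f w)"])
       (use min z p1 in \<open>auto intro!: has_derivative_snd D\<close>)
  ultimately show False
    using no_injective_linear_into_horizontal[OF has_derivative_linear[OF D] inj[OF z(1)]]
    by (metis (no_types))
qed

lemma hs_boundary_full: "hs_boundary (surf {-L<..<L} :: 'a::euclidean_space hyp_line set) = {}"
proof -
  have "p \<notin> hs_boundary (surf {-L<..<L})" if "p \<in> surf {-L<..<L}" for p :: "'a hyp_line"
    using that by (intro interior_point_not_boundary[of _ "{-L<..<L}"]) (auto simp: reaper_levels_def surf_def)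
  then show ?thesis by (auto simp: hs_boundary_def)
qed

lemma hs_boundary_half:
  "hs_boundary (surf {0..<L} :: 'a::euclidean_space hyp_line set) = horosphere None 0 \<times> {0}"
proof -
  have "p \<notin> hs_boundary (surf {0..<L})" if "p \<in> surf {0..<L}" "ln (snd (fst p)) \<noteq> 0"
    for p :: "'a hyp_line"
    using that by (intro interior_point_not_boundary[of _ "{0<..<L}"]) (auto simp: reaper_levels_def surf_def)
  moreover have "hs_boundary (surf {0..<L}) \<subseteq> (surf {0..<L} :: 'a hyp_line set)"
    unfolding hs_boundary_def by (rule Collect_restrict)
  ultimately have "hs_boundary (surf {0..<L}) = {p \<in> surf {0..<L} :: 'a hyp_line set. ln (snd (fst p)) = 0}"
    using minimal_point_is_boundary by blast
  also have "\<dots> = horosphere None 0 \<times> {0}"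
    using L_pos profile_zero by (auto simp: surf_def horosphere_None)
  finally show ?thesis .
qed

lemma surf_full_homeomorphic_UNIV:
  "(surf {-L<..<L} :: 'a::euclidean_space hyp_line set) homeomorphic (UNIV :: ('a \<times> real) set)"
proof -
  have "local_param 1 (surf {-L<..<L}) (UNIV :: ('a \<times> real) set) {z. snd z \<in> {-L<..<L}} chart
      {p. 0 < snd (fst p) \<and> ln (snd (fst p)) \<in> {-L<..<L}}"
    by (intro chart_local_param chart_C1) auto
  moreover have "surf {-L<..<L} \<inter> {p :: 'a hyp_line. 0 < snd (fst p) \<and> ln (snd (fst p)) \<in> {-L<..<L}}
      = surf {-L<..<L}" by (auto simp: surf_def)
  ultimately have "{z :: 'a \<times> real. snd z \<in> {-L<..<L}} homeomorphic (surf {-L<..<L} :: 'a hyp_line set)"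
    unfolding local_param_def homeomorphic_def by auto
  then show ?thesis
    using strip_homeomorphic_UNIV[of "-L" L] L_pos homeomorphic_trans homeomorphic_sym
    by (metis neg_less_pos)
qed

end

section \<open>Parabolic grim reapers\<close>

theorem theorem6:
  fixes n :: nat
  assumes "2 \<le> n" and "DIM('a::euclidean_space) = n - 1"
  shows
    "(odd n \<longrightarrow>
       (\<exists>(S :: 'a hyp_line set) \<xi> a b. a \<noteq> b \<and>
          n_translator S \<and> parabolic \<xi> S \<and> hs_boundary S = {} \<and>
          vertical_graph (horo_region \<xi> a b) S \<and>
          S homeomorphic (UNIV :: ('a \<times> real) set) \<and>
          bdd_below (height ` S) \<and> \<not> bdd_above (height ` S) \<and>
          vertically_asymptotic S (horosphere \<xi> a \<union> horosphere \<xi> b) \<and>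
          (\<exists>c h. lowest_points S = horosphere \<xi> c \<times> {h} \<and>
                 C2_singular_set S = lowest_points S))) \<and>
     (even n \<longrightarrow>
       (\<exists>(S :: 'a hyp_line set) \<xi> a b. a \<noteq> b \<and>
          n_translator S \<and> parabolic \<xi> S \<and>
          hs_boundary S \<noteq> {} \<and> hs_boundary S = horosphere \<xi> a \<times> {0} \<and>
          vertical_graph (horo_region \<xi> a b) (S - hs_boundary S) \<and>
          bdd_below (height ` S) \<and> \<not> bdd_above (height ` S) \<and>
          (\<forall>p \<in> horosphere \<xi> a \<times> {0}. tangent_space S p = tangent_space (hyp \<times> {0}) p) \<and>
          lowest_points S = horosphere \<xi> a \<times> {0} \<and>
          vertically_asymptotic S (horosphere \<xi> b)))"
proof -
  define m where "m = n - 1"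
  have m: "0 < m" "DIM('a) = m" "even n \<longleftrightarrow> odd m"
    using assms by (auto simp: m_def)
  obtain L \<theta> \<phi> where "reaper_profile m L \<theta> \<phi>" using reaper_profile_exists[OF m(1)] by blast
  then interpret reaper_profile m L \<theta> \<phi> .
  have full: "reaper_levels {-L<..<L}" and half: "reaper_levels {0..<L}" by (auto simp: reaper_levels_def)
  show ?thesis
  proof (intro conjI impI)
    assume "odd n"
    then have "even m" using m by simp
    let ?S = "surf {-L<..<L} :: 'a hyp_line set"
    (* An even power hides the sign of sin \<theta>, so the upward normal works on both halves. *)
    have translator: "n_translator ?S"
      by (rule n_translator_surf[OF m(2) full, of 1]) (use \<open>even m\<close> in \<open>auto simp: power_even_abs\<close>)
    have "vertically_asymptotic ?S
        {z :: 'a \<times> real. 0 < snd z \<and> ln (snd z) \<in> {-L, L}}"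
      using L_pos by (intro surf_asymptotic[OF full]) (auto simp: sgn_real_def)
    then have asymptotic: "vertically_asymptotic ?S (horosphere None (- L) \<union> horosphere None L)"
      by (rule back_subst[of "vertically_asymptotic ?S"]) (auto simp: horosphere_None)
    show "\<exists>(S :: 'a hyp_line set) \<xi> a b. a \<noteq> b \<and>
          n_translator S \<and> parabolic \<xi> S \<and> hs_boundary S = {} \<and>
          vertical_graph (horo_region \<xi> a b) S \<and>
          S homeomorphic (UNIV :: ('a \<times> real) set) \<and>
          bdd_below (height ` S) \<and> \<not> bdd_above (height ` S) \<and>
          vertically_asymptotic S (horosphere \<xi> a \<union> horosphere \<xi> b) \<and>
          (\<exists>c h. lowest_points S = horosphere \<xi> c \<times> {h} \<and> C2_singular_set S = lowest_points S)"
    proof (intro exI conjI)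
      show "- L \<noteq> L" using L_pos by simp
      show "parabolic None ?S" by (rule parabolic_surf)
      show "vertical_graph (horo_region None (- L) L) ?S"
        using L_pos by (intro vertical_graph_surf) auto
      show "lowest_points ?S = horosphere None 0 \<times> {0}" by (rule lowest_points_surf[OF full])
      then show "C2_singular_set ?S = lowest_points ?S" by (simp only: C2_singular_set_horosphere[OF full])
    qed (fact translator asymptotic hs_boundary_full surf_full_homeomorphic_UNIV height_surf[OF full])+
  next
    assume "even n"
    then have "odd m" using m by simp
    let ?S = "surf {0..<L} :: 'a hyp_line set"
    (* For odd m the downward normal turns the curvatures - sin \<theta> into sin \<theta> > 0. *)
    have translator: "n_translator ?S"
    proof (rule n_translator_surf[OF m(2) half, of "-1"])
      fix s assume "s \<in> {0..<L}" "s \<noteq> 0"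
      then show "(- (- 1 * sin (\<theta> s))) ^ m = \<bar>sin (\<theta> s)\<bar> ^ m" using sin_angle_pos[of s] by simp
    qed simp
    have "vertically_asymptotic ?S {z :: 'a \<times> real. 0 < snd z \<and> ln (snd z) \<in> {L}}"
      using L_pos by (intro surf_asymptotic[OF half]) (auto simp: sgn_real_def)
    then have asymptotic: "vertically_asymptotic ?S (horosphere None L)"
      by (rule back_subst[of "vertically_asymptotic ?S"]) (auto simp: horosphere_None)
    have "?S - hs_boundary ?S = surf {0<..<L}"
      unfolding hs_boundary_half using profile_zero
      by (auto simp: surf_def horosphere_None) (metis ln_one order_le_less)
    then have graph: "vertical_graph (horo_region None 0 L) (?S - hs_boundary ?S)"
      using vertical_graph_surf[of 0 L] L_pos by simp
    have "((0, 1), 0) \<in> (horosphere None 0 \<times> {0} :: 'a hyp_line set)"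
      by (simp add: horosphere_None)
    then have boundary: "hs_boundary ?S \<noteq> {}" unfolding hs_boundary_half by blast
    have tangent: "tangent_space ?S p = tangent_space (hyp \<times> {0}) p"
      if "p \<in> horosphere None 0 \<times> {0}" for p
    proof -
      have "p \<in> ?S" "p \<in> hyp \<times> {0}" "ln (snd (fst p)) = 0"
        using that L_pos profile_zero by (auto simp: surf_def horosphere_None hyp_def)
      then show ?thesis
        by (simp add: tangent_space_surf[OF half] tangent_space_slice tangent_plane_def)
    qed
    show "\<exists>(S :: 'a hyp_line set) \<xi> a b. a \<noteq> b \<and>
          n_translator S \<and> parabolic \<xi> S \<and>
          hs_boundary S \<noteq> {} \<and> hs_boundary S = horosphere \<xi> a \<times> {0} \<and>
          vertical_graph (horo_region \<xi> a b) (S - hs_boundary S) \<and>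
          bdd_below (height ` S) \<and> \<not> bdd_above (height ` S) \<and>
          (\<forall>p \<in> horosphere \<xi> a \<times> {0}. tangent_space S p = tangent_space (hyp \<times> {0}) p) \<and>
          lowest_points S = horosphere \<xi> a \<times> {0} \<and>
          vertically_asymptotic S (horosphere \<xi> b)"
    proof (intro exI conjI ballI)
      show "0 \<noteq> L" using L_pos by simp
      show "parabolic None ?S" by (rule parabolic_surf)
      show "lowest_points ?S = horosphere None 0 \<times> {0}" by (rule lowest_points_surf[OF half])
    qed (fact translator asymptotic graph boundary tangent hs_boundary_half height_surf[OF half])+
  qed
qed

end
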